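(* Let $\vec{v}\in\mathbb{R}^3$ be a non-zero vector. Planes and grim reapers are the only translating solitons with respect to $\vec{v}$ that are the sum of two curves, one of which is planar. That is: let $I,J\subset\mathbb{R}$ be open intervals, let $\alpha:I\to\mathbb{R}^3$ and $\beta:J\to\mathbb{R}^3$ be smooth curves such that $\beta$ is contained in some plane of $\mathbb{R}^3$, and suppose that $X(s,t)=\alpha(s)+\beta(t)$, $(s,t)\in I\times J$, parametrizes a regular surface that is a translating soliton with respect to $\vec{v}$. Then the surface is (part of) a plane or a grim reaper.
   Context: $\mathbb{R}^3$ is Euclidean space with its standard inner product $\langle\cdot,\cdot\rangle$. A translating soliton with respect to a non-zero vector $\vec{v}\in\mathbb{R}^3$ is a smooth surface $M\subset\mathbb{R}^3$ whose mean curvature $H$ satisfies $H(p)=\langle N(p),\vec{v}\rangle$ for all $p\in M$, where $N$ is the unit normal vector field on $M$. The convention is that $H$ is the average of the two principal curvatures with respect to $N$ (half the trace of the shape operator); thus for a graph $z=u(x,y)$ with $\vec{v}=(v_1,v_2,v_3)$ the equation reads $$(1+u_y^2)u_{xx}-2u_xu_yu_{xy}+(1+u_x^2)u_{yy}=2(1+u_x^2+u_y^2)(-v_1u_x-v_2u_y+v_3).$$ A cylindrical surface is a surface invariant under a one-parameter group of translations (i.e. ruled by parallel straight lines). A grim reaper (with respect to $\vec{v}$) is a non-planar cylindrical surface that is a translating soliton with respect to $\vec{v}$; its rulings are necessarily not parallel to $\vec{v}$. No relation is assumed between $\vec{v}$ and the curves or the coordinates. *)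

theory Defs
  imports "HOL-Analysis.Analysis"
begin

section \<open>Smooth maps on open sets\<close>

definition dir_deriv ::
  "('a::real_normed_vector \<Rightarrow> 'b::real_normed_vector) \<Rightarrow> 'a \<Rightarrow> 'a \<Rightarrow> 'b" where
  "dir_deriv f w = (\<lambda>x. frechet_derivative f (at x) w)"

fun Ck_on :: "nat \<Rightarrow> 'a::real_normed_vector set \<Rightarrow> ('a \<Rightarrow> 'b::real_normed_vector) \<Rightarrow> bool" where
  "Ck_on 0 S f \<longleftrightarrow> continuous_on S f"
| "Ck_on (Suc k) S f \<longleftrightarrow>
     (\<forall>x\<in>S. f differentiable (at x)) \<and> (\<forall>w. Ck_on k S (dir_deriv f w))"

definition smooth_on :: "'a::real_normed_vector set \<Rightarrow> ('a \<Rightarrow> 'b::real_normed_vector) \<Rightarrow> bool" where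
  "smooth_on S f \<longleftrightarrow> (\<forall>k. Ck_on k S f)"


section \<open>Parametrized surfaces in Euclidean 3-space\<close>

text \<open>Parametrizations have the type \<open>real \<times> real \<Rightarrow> real^3\<close>.\<close>

abbreviation partial_u :: "(real \<times> real \<Rightarrow> 'b::real_normed_vector) \<Rightarrow> real \<times> real \<Rightarrow> 'b" where
  "partial_u f \<equiv> dir_deriv f (1, 0)"

abbreviation partial_v :: "(real \<times> real \<Rightarrow> 'b::real_normed_vector) \<Rightarrow> real \<times> real \<Rightarrow> 'b" where
  "partial_v f \<equiv> dir_deriv f (0, 1)"

text \<open>A regular parametrization is an immersion; injectivity is not required here.\<close>

definition regular_param :: "(real \<times> real) set \<Rightarrow> (real \<times> real \<Rightarrow> real^3) \<Rightarrow> bool" where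
  "regular_param U X \<longleftrightarrow>
     open U \<and> smooth_on U X \<and> (\<forall>p\<in>U. cross3 (partial_u X p) (partial_v X p) \<noteq> 0)"

definition unit_normal :: "(real \<times> real \<Rightarrow> real^3) \<Rightarrow> real \<times> real \<Rightarrow> real^3" where
  "unit_normal X p = sgn (cross3 (partial_u X p) (partial_v X p))"

definition first_form :: "(real \<times> real \<Rightarrow> real^3) \<Rightarrow> real \<times> real \<Rightarrow> real^2^2" where
  "first_form X p =
     vector [vector [partial_u X p \<bullet> partial_u X p, partial_u X p \<bullet> partial_v X p],
             vector [partial_v X p \<bullet> partial_u X p, partial_v X p \<bullet> partial_v X p]]"

definition second_form :: "(real \<times> real \<Rightarrow> real^3) \<Rightarrow> real \<times> real \<Rightarrow> real^2^2" where
  "second_form X p =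
     vector [vector [unit_normal X p \<bullet> partial_u (partial_u X) p,
                     unit_normal X p \<bullet> partial_u (partial_v X) p],
             vector [unit_normal X p \<bullet> partial_v (partial_u X) p,
                     unit_normal X p \<bullet> partial_v (partial_v X) p]]"

text \<open>The matrix of the shape operator \<open>- dN\<close> in the basis \<open>X\<^sub>u, X\<^sub>v\<close> of the tangent
  plane (Weingarten equations). The mean curvature is the average, not the sum, of the
  principal curvatures.\<close>

definition shape_operator :: "(real \<times> real \<Rightarrow> real^3) \<Rightarrow> real \<times> real \<Rightarrow> real^2^2" where
  "shape_operator X p = matrix_inv (first_form X p) ** second_form X p"

definition mean_curvature :: "(real \<times> real \<Rightarrow> real^3) \<Rightarrow> real \<times> real \<Rightarrow> real" where
  "mean_curvature X p = trace (shape_operator X p) / 2"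

lemma trace_matrix_inv_mult_2:
  fixes E F G a b c e d :: real
  assumes d: "E * G - F * F = d" "d \<noteq> 0"
  defines "A \<equiv> vector [vector [E, F], vector [F, G]] :: real^2^2"
  shows "trace (matrix_inv A ** (vector [vector [a, b], vector [c, e]] :: real^2^2)) =
    (G * a - F * b - F * c + E * e) / d"
proof -
  define B where "B = (vector [vector [G / d, - F / d], vector [- F / d, E / d]] :: real^2^2)"
  have 1: "E * (G / d) - F * (F / d) = 1"
    using d by (metis diff_divide_distrib divide_self times_divide_eq_right)
  have inv: "A ** B = mat 1" "B ** A = mat 1"
    using 1 unfolding A_def B_def
    by (simp_all add: vec_eq_iff forall_2 matrix_matrix_mult_def sum_2 mat_def ac_simps)
  have "C = B" if "A ** C = mat 1" for C
    by (metis inv(2) that matrix_mul_assoc matrix_mul_lid matrix_mul_rid)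
  then have Binv: "matrix_inv A = B"
    unfolding matrix_inv_def using inv by (metis (mono_tags, lifting) some_equality)
  show ?thesis
    unfolding Binv B_def
    by (simp add: trace_def sum_2 matrix_matrix_mult_def add_divide_distrib diff_divide_distrib)
qed

lemma mean_curvature_classical:
  assumes "cross3 (partial_u X p) (partial_v X p) \<noteq> 0"
  defines "E \<equiv> partial_u X p \<bullet> partial_u X p"
    and "F \<equiv> partial_u X p \<bullet> partial_v X p"
    and "G \<equiv> partial_v X p \<bullet> partial_v X p"
  shows "mean_curvature X p =
     (G * (unit_normal X p \<bullet> partial_u (partial_u X) p)
      - F * (unit_normal X p \<bullet> partial_u (partial_v X) p)
      - F * (unit_normal X p \<bullet> partial_v (partial_u X) p)
      + E * (unit_normal X p \<bullet> partial_v (partial_v X) p)) / (2 * (E * G - F\<^sup>2))"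
proof -
  have "(norm (cross3 (partial_u X p) (partial_v X p)))\<^sup>2 = E * G - F\<^sup>2"
    unfolding norm_cross E_def F_def G_def by (simp add: power2_norm_eq_inner)
  then have d: "E * G - F * F \<noteq> 0"
    using assms(1) by (auto simp: power2_eq_square)
  have A: "first_form X p = vector [vector [E, F], vector [F, G]]"
    by (simp add: first_form_def E_def F_def G_def inner_commute)
  show ?thesis
    unfolding mean_curvature_def shape_operator_def second_form_def A
      trace_matrix_inv_mult_2[OF refl d] power2_eq_square
    by (simp only: divide_divide_eq_left mult.commute)
qed

text \<open>Reversing the normal changes the sign of both sides of the soliton equation, so the
  condition does not depend on the orientation given by \<open>X\<close>.\<close>

definition soliton_param :: "real^3 \<Rightarrow> (real \<times> real) set \<Rightarrow> (real \<times> real \<Rightarrow> real^3) \<Rightarrow> bool" where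
  "soliton_param v U X \<longleftrightarrow>
     regular_param U X \<and> (\<forall>p\<in>U. mean_curvature X p = unit_normal X p \<bullet> v)"


section \<open>Surfaces as subsets of Euclidean 3-space\<close>

definition local_param :: "(real^3) set \<Rightarrow> (real \<times> real) set \<Rightarrow> (real \<times> real \<Rightarrow> real^3) \<Rightarrow> bool" where
  "local_param M U X \<longleftrightarrow>
     regular_param U X \<and> openin (top_of_set M) (X ` U) \<and> (\<exists>Y. homeomorphism U (X ` U) X Y)"

definition regular_surface :: "(real^3) set \<Rightarrow> bool" where
  "regular_surface M \<longleftrightarrow> (\<forall>q\<in>M. \<exists>U X. local_param M U X \<and> q \<in> X ` U)"

text \<open>The mean curvature and the normal at a point of \<open>M\<close> are computed in a local
  parametrization around that point; up to a common sign they do not depend on its choice.\<close>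

definition translating_soliton :: "real^3 \<Rightarrow> (real^3) set \<Rightarrow> bool" where
  "translating_soliton v M \<longleftrightarrow>
     regular_surface M \<and>
     (\<forall>q\<in>M. \<exists>U X. local_param M U X \<and> q \<in> X ` U \<and> soliton_param v U X)"

definition is_plane :: "(real^3) set \<Rightarrow> bool" where
  "is_plane P \<longleftrightarrow> affine P \<and> aff_dim P = 2"

definition cylindrical :: "(real^3) set \<Rightarrow> bool" where
  "cylindrical M \<longleftrightarrow> (\<exists>w. w \<noteq> 0 \<and> (\<forall>r::real. (\<lambda>q. q + r *\<^sub>R w) ` M = M))"

definition grim_reaper :: "real^3 \<Rightarrow> (real^3) set \<Rightarrow> bool" where
  "grim_reaper v M \<longleftrightarrow>
     translating_soliton v M \<and> connected M \<and> cylindrical M \<and> \<not> (\<exists>P. is_plane P \<and> M \<subseteq> P)"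

end

theory Submission
  imports Defs "HOL-Computational_Algebra.Polynomial"
begin

text \<open>Write \<open>a = \<alpha>'\<close> and \<open>b = \<beta>'\<close>, and let \<open>e\<^sub>3\<close> be a unit normal of the plane of \<open>\<beta>\<close>. The
  soliton equation reads
  \<open>|b|\<^sup>2 (a \<times> b) \<bullet> a' + |a|\<^sup>2 (a \<times> b) \<bullet> b' = 2 |a \<times> b|\<^sup>2 (a \<times> b) \<bullet> v\<close>.
  If \<open>a \<bullet> e\<^sub>3\<close> vanishes identically the surface is planar, and if \<open>\<beta>\<close> has no curvature it is
  a line. Otherwise the equation, divided by \<open>|a|\<^sup>2 (a \<bullet> e\<^sub>3)\<close>, expresses the curvature of \<open>\<beta>\<close>
  at infinitely many slopes \<open>m\<close> of \<open>b\<close> as a cubic polynomial in \<open>m\<close>, which therefore does not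
  depend on the parameter of \<open>\<alpha>\<close>. Its value at \<open>m = \<i>\<close> gives
  \<open>A\<^sup>2 (v\<^sub>3 A - (v\<^sub>1 + \<i> v\<^sub>2)) = c (1 + |A|\<^sup>2)\<close> with a constant \<open>c\<close>, where
  \<open>A = (a\<^sub>1 + \<i> a\<^sub>2) / a\<^sub>3\<close>. This equation has only finitely many solutions, so by continuity
  \<open>A\<close> is constant and \<open>\<alpha>\<close> is a line.

  When one curve is a line with direction \<open>w\<close>, the projection \<open>(x, y)\<close> of the other one along
  \<open>w\<close>, with the \<open>y\<close>-axis in the direction of the projection of \<open>v\<close>, of length \<open>\<kappa>\<close>, has the
  first integral \<open>exp (2 \<kappa> y) cos \<theta>\<close>, where \<open>\<theta>\<close> is the angle of its tangent. It is a line if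
  this constant is zero; otherwise \<open>\<theta> - 2 \<kappa> x\<close> is constant too, which gives the grim reaper curve
  \<open>2 \<kappa> y = - ln (cos (2 \<kappa> x))\<close> up to a translation.\<close>

unbundle cross3_syntax


section \<open>Directional derivatives\<close>

lemma dir_deriv_eq:
  assumes "(f has_derivative f') (at x)"
  shows "dir_deriv f w x = f' w"
  using frechet_derivative_at[OF assms] by (simp add: dir_deriv_def)

lemma dir_deriv_cong:
  assumes "open S" "x \<in> S" "\<And>y. y \<in> S \<Longrightarrow> f y = g y"
  shows "dir_deriv f w x = dir_deriv g w x"
proof -
  have "(f has_derivative D) (at x) \<longleftrightarrow> (g has_derivative D) (at x)" for D
    using has_derivative_transform_within_open[of f D x UNIV S g]
      has_derivative_transform_within_open[of g D x UNIV S f] assms by auto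
  then show ?thesis
    by (simp add: dir_deriv_def frechet_derivative_def)
qed

text \<open>On an open set derivatives depend only on the values in the set, so a derivative may be
  replaced by a closed formula valid on \<open>S\<close> before the recursion of
  \<open>Ck_on\<close> continues.\<close>

lemma Ck_on_cong:
  assumes "open S" "\<And>y. y \<in> S \<Longrightarrow> f y = g y" "Ck_on k S f"
  shows "Ck_on k S g"
  using assms(2,3)
proof (induction k arbitrary: f g)
  case 0
  then show ?case by (simp cong: continuous_on_cong_simp)
next
  case (Suc k)
  have "g differentiable (at x)" if "x \<in> S" for x
  proof -
    have "f differentiable (at x)"
      using Suc.prems(2) that by simp
    then show ?thesis
      unfolding differentiable_def
      using has_derivative_transform_within_open[of f _ x UNIV S g] assms(1) that Suc.prems(1)
      by auto
  qed
  moreover have "Ck_on k S (dir_deriv g w)" for w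
    using Suc.IH[of "dir_deriv f w" "dir_deriv g w"] Suc.prems
      dir_deriv_cong[OF assms(1), of _ f g w] by auto
  ultimately show ?case by simp
qed

lemma smooth_on_dir_deriv: "smooth_on S f \<Longrightarrow> smooth_on S (dir_deriv f w)"
  unfolding smooth_on_def by (metis Ck_on.simps(2))

lemma smooth_on_has_vector_derivative:
  fixes f :: "real \<Rightarrow> 'a::real_normed_vector"
  assumes "smooth_on S f" "x \<in> S"
  shows "(f has_vector_derivative dir_deriv f 1 x) (at x)"
proof -
  have "f differentiable (at x)"
  proof -
    have "Ck_on (Suc 0) S f"
      using assms(1) unfolding smooth_on_def by (rule spec)
    then show ?thesis
      using assms(2) by simp
  qed
  then have D: "(f has_derivative frechet_derivative f (at x)) (at x)"
    using frechet_derivative_works by blast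
  have "frechet_derivative f (at x) = (\<lambda>h. h *\<^sub>R dir_deriv f 1 x)"
  proof
    fix h
    have "h = h *\<^sub>R 1" by simp
    then show "frechet_derivative f (at x) h = h *\<^sub>R dir_deriv f 1 x"
      unfolding dir_deriv_def by (metis linear_scale[OF has_derivative_linear[OF D]])
  qed
  with D show ?thesis
    unfolding has_vector_derivative_def by (simp only:)
qed

lemma constant_on_interval:
  fixes f :: "real \<Rightarrow> 'a::real_normed_vector"
  assumes "is_interval S" "\<And>x. x \<in> S \<Longrightarrow> (f has_vector_derivative 0) (at x)"
  shows "\<exists>c. \<forall>x\<in>S. f x = c"
  using has_vector_derivative_zero_constant[of S f] assms
  by (meson has_vector_derivative_at_within is_interval_convex)

lemma has_derivative_comp_linear:
  fixes g :: "real \<Rightarrow> 'b::real_normed_vector"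
  assumes "bounded_linear L" "(g has_vector_derivative g') (at (L p))"
  shows "((\<lambda>p. g (L p)) has_derivative (\<lambda>h. L h *\<^sub>R g')) (at p)"
  using has_derivative_compose[OF bounded_linear_imp_has_derivative[OF assms(1)], of g] assms(2)
  by (simp add: has_vector_derivative_def)

lemma has_real_derivative_inner:
  assumes "(g has_vector_derivative g') (at t)"
  shows "((\<lambda>t. g t \<bullet> u) has_real_derivative g' \<bullet> u) (at t)"
  using bounded_linear.has_vector_derivative[OF bounded_linear_inner_left assms]
  by (simp add: has_real_derivative_iff_has_vector_derivative)

lemma inner_constant_on_interval:
  assumes "is_interval S" "\<And>t. t \<in> S \<Longrightarrow> (g has_vector_derivative g' t) (at t)"
    and "\<And>t. t \<in> S \<Longrightarrow> g' t \<bullet> u = 0"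
  obtains c where "\<And>t. t \<in> S \<Longrightarrow> g t \<bullet> u = c"
  using constant_on_interval[of S "\<lambda>t. g t \<bullet> u"] assms has_real_derivative_inner
  by (metis has_real_derivative_iff_has_vector_derivative)

lemma derivative_inner_constant:
  assumes "open S" "t \<in> S" "(g has_vector_derivative g') (at t)"
    and "\<And>t. t \<in> S \<Longrightarrow> g t \<bullet> u = c"
  shows "g' \<bullet> u = 0"
proof -
  have "((\<lambda>t. g t \<bullet> u) has_real_derivative 0) (at t)"
    using has_field_derivative_transform_within_open[OF DERIV_const[of c] assms(1,2)] assms(4)
    by metis
  then show ?thesis
    using DERIV_unique has_real_derivative_inner[OF assms(3)] by blast
qed


section \<open>Orthonormal frames\<close>

text \<open>A positively oriented orthonormal basis; \<open>w = f \<times> e\<close> makes the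
  remaining orthogonality relations and the cyclic product rules consequences.\<close>

definition frame :: "real^3 \<Rightarrow> real^3 \<Rightarrow> real^3 \<Rightarrow> bool" where
  "frame f e w \<longleftrightarrow> f \<bullet> f = 1 \<and> e \<bullet> e = 1 \<and> f \<bullet> e = 0 \<and> w = f \<times> e"

lemma frame_facts:
  assumes "frame f e w"
  shows "f \<bullet> f = 1" "e \<bullet> e = 1" "w \<bullet> w = 1"
    and "f \<bullet> e = 0" "e \<bullet> f = 0" "f \<bullet> w = 0" "w \<bullet> f = 0" "e \<bullet> w = 0" "w \<bullet> e = 0"
    and "f \<times> e = w" "e \<times> w = f" "w \<times> f = e"
  using assms unfolding frame_def
  by (auto simp: dot_cross inner_commute dot_cross_self Lagrange cross_skew[of "f \<times> e" f])

lemma frame_expand: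
  assumes F: "frame f e w"
  shows "x = (x \<bullet> f) *\<^sub>R f + (x \<bullet> e) *\<^sub>R e + (x \<bullet> w) *\<^sub>R w"
proof -
  note ff = frame_facts[OF F]
  define r where "r = x - ((x \<bullet> f) *\<^sub>R f + (x \<bullet> e) *\<^sub>R e + (x \<bullet> w) *\<^sub>R w)"
  have o: "r \<bullet> f = 0" "r \<bullet> e = 0" "r \<bullet> w = 0"
    by (simp_all add: r_def inner_diff_left inner_add_left ff)
  \<comment> \<open>By the Lagrange formula this product is a combination of \<open>f\<close> and
    \<open>e\<close> with coefficients \<open>r \<bullet> e\<close> and \<open>r \<bullet> f\<close>
    up to sign. So \<open>r\<close> is both parallel and orthogonal to the unit vector
    \<open>w\<close>.\<close>
  have "r \<times> (f \<times> e) = 0"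
    using o by (simp add: Lagrange)
  then have "r \<times> w = 0"
    by (simp add: ff)
  then have "r = 0"
    using norm_cross_dot[of r w] o ff by (auto simp: norm_eq_sqrt_inner)
  then show ?thesis
    by (simp add: r_def)
qed

lemma frame_inner:
  assumes F: "frame f e w"
  shows "x \<bullet> y = (x \<bullet> f) * (y \<bullet> f) + (x \<bullet> e) * (y \<bullet> e) + (x \<bullet> w) * (y \<bullet> w)"
  by (subst frame_expand[OF F, of x]) (simp add: inner_add_left inner_add_right inner_commute)

lemma frame_cross:
  assumes F: "frame f e w"
  shows "(x \<times> y) \<bullet> f = (x \<bullet> e) * (y \<bullet> w) - (x \<bullet> w) * (y \<bullet> e)"
    and "(x \<times> y) \<bullet> e = (x \<bullet> w) * (y \<bullet> f) - (x \<bullet> f) * (y \<bullet> w)"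
    and "(x \<times> y) \<bullet> w = (x \<bullet> f) * (y \<bullet> e) - (x \<bullet> e) * (y \<bullet> f)"
  using dot_cross[of x y e w] dot_cross[of x y w f] dot_cross[of x y f e]
  by (simp_all add: frame_facts[OF F])

lemma frame_exists:
  assumes "w \<bullet> w = 1" "f \<bullet> w = 0" "f \<noteq> 0"
  shows "frame (sgn f) (w \<times> sgn f) w"
proof -
  have 1: "sgn f \<bullet> sgn f = 1"
    using assms(3) norm_sgn[of f] by (simp add: dot_square_norm)
  have 2: "sgn f \<bullet> w = 0"
    using assms by (simp add: sgn_div_norm)
  show ?thesis
    using assms(1) 1 2 unfolding frame_def
    by (simp add: dot_cross inner_commute dot_cross_self Lagrange)
qed

text \<open>The fixed vector \<open>(w \<times> g') \<times> w\<close> is orthogonal to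
  \<open>w\<close>, hence to every \<open>g t\<close> and to the derivative \<open>g'\<close>; but
  its product with \<open>g'\<close> is the squared length of \<open>w \<times> g'\<close>. In this
  way \<open>\<rho>\<close> never has to be differentiated.\<close>

lemma derivative_parallel:
  fixes g :: "real \<Rightarrow> real^3"
  assumes "open S" "t \<in> S" "(g has_vector_derivative g') (at t)"
    and g: "\<And>t. t \<in> S \<Longrightarrow> g t = \<rho> t *\<^sub>R w"
  shows "w \<times> g' = 0"
proof -
  have "g t \<bullet> ((w \<times> g') \<times> w) = 0" if "t \<in> S" for t
    by (simp add: g[OF that] dot_cross_self)
  then have "g' \<bullet> ((w \<times> g') \<times> w) = 0"
    using derivative_inner_constant[OF assms(1-3)] by blast
  then have "(w \<times> g') \<bullet> (w \<times> g') = 0"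
    by (metis cross_triple inner_commute)
  then show ?thesis
    by simp
qed

lemma is_plane_hyperplane:
  assumes "is_plane P"
  obtains n d where "n \<noteq> 0" "P = {x. n \<bullet> x = d}"
proof -
  have "affine hull P = P" "aff_dim P = DIM(real^3) - 1"
    using assms by (simp_all add: is_plane_def hull_same)
  then show ?thesis
    using aff_dim_eq_hyperplane[of P] that by metis
qed

lemma hyperplane_is_plane:
  fixes n :: "real^3"
  shows "n \<noteq> 0 \<Longrightarrow> is_plane {x. n \<bullet> x = d}"
  by (simp add: is_plane_def affine_hyperplane)


section \<open>The soliton equation for a sum of two curves\<close>

text \<open>Arbitrary directions \<open>h\<close> and \<open>k\<close> give all partial derivatives
  at once. The coefficients show that the mixed second derivatives vanish.\<close>

lemma sum_curves_partials:
  fixes \<alpha> \<beta> a b :: "real \<Rightarrow> real^3"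
  assumes I: "open I" and J: "open J" and st: "s \<in> I" "t \<in> J"
    and \<alpha>: "\<And>s. s \<in> I \<Longrightarrow> (\<alpha> has_vector_derivative a s) (at s)"
    and a: "\<And>s. s \<in> I \<Longrightarrow> (a has_vector_derivative a' s) (at s)"
    and \<beta>: "\<And>t. t \<in> J \<Longrightarrow> (\<beta> has_vector_derivative b t) (at t)"
    and b: "\<And>t. t \<in> J \<Longrightarrow> (b has_vector_derivative b' t) (at t)"
  defines "X \<equiv> \<lambda>(s, t). \<alpha> s + \<beta> t"
  shows "(X has_derivative (\<lambda>h. fst h *\<^sub>R a s + snd h *\<^sub>R b t)) (at (s, t))"
    and "dir_deriv X h (s, t) = fst h *\<^sub>R a s + snd h *\<^sub>R b t"
    and "dir_deriv (dir_deriv X h) k (s, t) = (fst h * fst k) *\<^sub>R a' s + (snd h * snd k) *\<^sub>R b' t"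
proof -
  note cf = has_derivative_comp_linear[OF bounded_linear_fst]
    and cs = has_derivative_comp_linear[OF bounded_linear_snd]
  have D: "(X has_derivative (\<lambda>h. fst h *\<^sub>R a s + snd h *\<^sub>R b t)) (at (s, t))"
    if "s \<in> I" "t \<in> J" for s t
    unfolding X_def case_prod_beta
    by (intro has_derivative_add cf cs) (simp_all add: \<alpha> \<beta> that)
  then show "(X has_derivative (\<lambda>h. fst h *\<^sub>R a s + snd h *\<^sub>R b t)) (at (s, t))"
    and "dir_deriv X h (s, t) = fst h *\<^sub>R a s + snd h *\<^sub>R b t"
    using dir_deriv_eq st by blast+
  have "dir_deriv (dir_deriv X h) k (s, t) =
      dir_deriv (\<lambda>p. fst h *\<^sub>R a (fst p) + snd h *\<^sub>R b (snd p)) k (s, t)"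
    by (intro dir_deriv_cong[of "Sigma I (\<lambda>_. J)"])
      (use I J st in \<open>auto simp: open_Times intro!: dir_deriv_eq[OF D, THEN trans]\<close>)
  also have "\<dots> = fst h *\<^sub>R (fst k *\<^sub>R a' s) + snd h *\<^sub>R (snd k *\<^sub>R b' t)"
    by (intro dir_deriv_eq[of _ "\<lambda>k. fst h *\<^sub>R (fst k *\<^sub>R a' s) + snd h *\<^sub>R (snd k *\<^sub>R b' t)"]
        has_derivative_add has_derivative_scaleR_right cf cs)
      (simp_all add: a b st)
  finally show "dir_deriv (dir_deriv X h) k (s, t) = (fst h * fst k) *\<^sub>R a' s + (snd h * snd k) *\<^sub>R b' t"
    by simp
qed

text \<open>Without mixed terms the classical formula keeps two summands, its denominator is twice
  the squared length of \<open>n\<close> by the Lagrange identity, and the unit normal is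
  \<open>n / norm n\<close>. Over the common denominator
  \<open>norm n * (2 * (n \<bullet> n))\<close> only the numerators are compared.\<close>

lemma sum_curves_soliton_eq:
  fixes \<alpha> \<beta> a b :: "real \<Rightarrow> real^3"
  assumes I: "open I" and J: "open J" and st: "s \<in> I" "t \<in> J"
    and \<alpha>: "\<And>s. s \<in> I \<Longrightarrow> (\<alpha> has_vector_derivative a s) (at s)"
    and a: "\<And>s. s \<in> I \<Longrightarrow> (a has_vector_derivative a' s) (at s)"
    and \<beta>: "\<And>t. t \<in> J \<Longrightarrow> (\<beta> has_vector_derivative b t) (at t)"
    and b: "\<And>t. t \<in> J \<Longrightarrow> (b has_vector_derivative b' t) (at t)"
    and n: "a s \<times> b t \<noteq> 0"
  defines "X \<equiv> \<lambda>(s, t). \<alpha> s + \<beta> t"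
  defines "n \<equiv> a s \<times> b t"
  shows "mean_curvature X (s, t) = unit_normal X (s, t) \<bullet> v \<longleftrightarrow>
    (b t \<bullet> b t) * (n \<bullet> a' s) + (a s \<bullet> a s) * (n \<bullet> b' t) = 2 * (n \<bullet> n) * (n \<bullet> v)"
proof -
  note P = sum_curves_partials[OF I J st \<alpha> a \<beta> b, folded X_def]
  have Xu: "partial_u X (s, t) = a s" and Xv: "partial_v X (s, t) = b t"
    by (simp_all add: P)
  have N: "unit_normal X (s, t) = n /\<^sub>R norm n"
    by (simp add: unit_normal_def Xu Xv n_def sgn_div_norm)
  have nn: "n \<bullet> n = (a s \<bullet> a s) * (b t \<bullet> b t) - (a s \<bullet> b t)\<^sup>2"
    by (simp add: n_def dot_cross power2_eq_square inner_commute)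
  have n0: "norm n \<noteq> 0" "n \<bullet> n \<noteq> 0"
    using n by (simp_all add: n_def)
  have "mean_curvature X (s, t) =
      ((b t \<bullet> b t) * (n \<bullet> a' s) + (a s \<bullet> a s) * (n \<bullet> b' t)) / (norm n * (2 * (n \<bullet> n)))"
  proof -
    have "mean_curvature X (s, t) =
        ((b t \<bullet> b t) * (n \<bullet> a' s) + (a s \<bullet> a s) * (n \<bullet> b' t)) / norm n / (2 * (n \<bullet> n))"
      using mean_curvature_classical[of X "(s, t)"] n
      unfolding Xu Xv N nn by (simp add: P add_divide_distrib divide_inverse algebra_simps)
    then show ?thesis
      by (simp only: divide_divide_eq_left)
  qed
  moreover have "unit_normal X (s, t) \<bullet> v = (2 * (n \<bullet> n) * (n \<bullet> v)) / (norm n * (2 * (n \<bullet> n)))"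
    unfolding N using n0 by (simp add: divide_simps)
  moreover have "norm n * (2 * (n \<bullet> n)) \<noteq> 0"
    using n0 by simp
  ultimately show ?thesis
    by (simp only: divide_cancel_right) blast
qed


section \<open>Grim reaper cylinders\<close>

text \<open>Since the derivative of tan is \<open>1 + tan^2\<close>, polynomials in tan are closed
  under differentiation: \<open>p\<close> becomes \<open>p' * (1 + X^2)\<close>.\<close>

lemma has_vector_derivative_poly_tan:
  fixes p :: "real poly" and e c :: "'a::real_normed_vector"
  assumes "cos x \<noteq> 0"
  shows "((\<lambda>x. poly p (tan x) *\<^sub>R e + c) has_vector_derivative
    (poly (pderiv p * [:1, 0, 1:]) (tan x)) *\<^sub>R e) (at x)"
proof -
  have "((\<lambda>x. poly p (tan x)) has_real_derivative
      poly (pderiv p) (tan x) * inverse ((cos x)\<^sup>2)) (at x)"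
    using DERIV_chain[OF poly_DERIV[of p] DERIV_tan[OF assms]] by (simp add: o_def)
  moreover have "inverse ((cos x)\<^sup>2) = 1 + tan x * tan x"
    using tan_sec[OF assms] by (simp add: power2_eq_square power_inverse)
  ultimately have "((\<lambda>x. poly p (tan x)) has_vector_derivative
      poly (pderiv p * [:1, 0, 1:]) (tan x)) (at x)"
    by (simp add: has_real_derivative_iff_has_vector_derivative algebra_simps)
  then have "((\<lambda>x. poly p (tan x) *\<^sub>R e) has_vector_derivative
      (poly (pderiv p * [:1, 0, 1:]) (tan x)) *\<^sub>R e) (at x)"
    by (auto simp: has_vector_derivative_def intro!: derivative_eq_intros)
  then show ?thesis
    by (simp add: has_vector_derivative_add_const)
qed

text \<open>Each directional derivative has the same form, with a new polynomial and
  \<open>c = 0\<close>, so induction on \<open>k\<close> for all \<open>p\<close> and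
  \<open>c\<close> succeeds.\<close>

lemma Ck_on_poly_tan:
  fixes p :: "real poly" and e c :: "'a::real_normed_vector"
  assumes S: "open S" "\<And>x. x \<in> S \<Longrightarrow> cos (fst x) \<noteq> 0"
  shows "Ck_on k S (\<lambda>x::real \<times> real. poly p (tan (fst x)) *\<^sub>R e + c)"
proof -
  have D: "((\<lambda>x::real \<times> real. poly p (tan (fst x)) *\<^sub>R e + c) has_derivative
      (\<lambda>h. fst h *\<^sub>R ((poly (pderiv p * [:1, 0, 1:]) (tan (fst x))) *\<^sub>R e))) (at x)"
    if "x \<in> S" for x p c
    using has_derivative_comp_linear[OF bounded_linear_fst has_vector_derivative_poly_tan] S that by blast
  show ?thesis
  proof (induction k arbitrary: p c)
    case 0
    show ?case
      using D by (auto intro!: continuous_at_imp_continuous_on has_derivative_continuous)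
  next
    case (Suc k)
    have "Ck_on k S (dir_deriv (\<lambda>x::real \<times> real. poly p (tan (fst x)) *\<^sub>R e + c) h)" for h
      by (rule Ck_on_cong[OF S(1) _ Suc.IH[of "smult (fst h) (pderiv p * [:1, 0, 1:])" 0]])
        (subst dir_deriv_eq[OF D], auto)
    then show ?case
      using differentiableI[OF D] by simp
  qed
qed

text \<open>The curve \<open>2 \<kappa> y = - ln (cos (2 \<kappa> x))\<close> in the plane through
  \<open>p\<close> spanned by \<open>f\<close> and \<open>e\<close>, parametrized by
  \<open>\<xi> = 2 \<kappa> x\<close>, which is also the angle of its tangent.\<close>

definition reaper_profile :: "real^3 \<Rightarrow> real^3 \<Rightarrow> real \<Rightarrow> real^3 \<Rightarrow> real \<Rightarrow> real^3" where
  "reaper_profile f e \<kappa> p \<xi> = p + (1 / (2 * \<kappa>)) *\<^sub>R (\<xi> *\<^sub>R f - ln (cos \<xi>) *\<^sub>R e)"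

definition reaper_param ::
  "real^3 \<Rightarrow> real^3 \<Rightarrow> real^3 \<Rightarrow> real \<Rightarrow> real^3 \<Rightarrow> real \<times> real \<Rightarrow> real^3" where
  "reaper_param f e w \<kappa> p = (\<lambda>(\<xi>, r). reaper_profile f e \<kappa> p \<xi> + r *\<^sub>R w)"

text \<open>A product of sets, written with \<open>Sigma\<close> because \<open>\<times>\<close> denotes the cross product here.\<close>

abbreviation strip :: "(real \<times> real) set" where
  "strip \<equiv> Sigma {-(pi/2)<..<pi/2} (\<lambda>_. UNIV)"

lemma reaper_profile_deriv:
  assumes "\<xi> \<in> {-(pi/2)<..<pi/2}"
  shows "(reaper_profile f e \<kappa> p has_vector_derivative (1 / (2 * \<kappa>)) *\<^sub>R (f + tan \<xi> *\<^sub>R e)) (at \<xi>)"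
    and "((\<lambda>\<xi>. (1 / (2 * \<kappa>)) *\<^sub>R (f + tan \<xi> *\<^sub>R e)) has_vector_derivative
      ((1 + (tan \<xi>)\<^sup>2) / (2 * \<kappa>)) *\<^sub>R e) (at \<xi>)"
proof -
  have c: "cos \<xi> > 0"
    using assms by (simp add: cos_gt_zero_pi)
  have "((\<lambda>\<xi>. ln (cos \<xi>)) has_real_derivative - tan \<xi>) (at \<xi>)"
    using c by (auto intro!: derivative_eq_intros simp: tan_def)
  then have "((\<lambda>\<xi>. ln (cos \<xi>) *\<^sub>R e) has_vector_derivative (- tan \<xi>) *\<^sub>R e) (at \<xi>)"
    using has_vector_derivative_scaleR[OF _ has_vector_derivative_const[of e]] by force
  moreover have "((\<lambda>\<xi>. \<xi> *\<^sub>R f) has_vector_derivative f) (at \<xi>)"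
    by (auto intro!: derivative_eq_intros simp: has_vector_derivative_def)
  ultimately have "((\<lambda>\<xi>. \<xi> *\<^sub>R f - ln (cos \<xi>) *\<^sub>R e) has_vector_derivative f - (- tan \<xi>) *\<^sub>R e) (at \<xi>)"
    by (rule has_vector_derivative_diff[rotated])
  then have "((\<lambda>\<xi>. (1 / (2 * \<kappa>)) *\<^sub>R (\<xi> *\<^sub>R f - ln (cos \<xi>) *\<^sub>R e)) has_vector_derivative
      (1 / (2 * \<kappa>)) *\<^sub>R (f - (- tan \<xi>) *\<^sub>R e)) (at \<xi>)"
    by (rule bounded_linear.has_vector_derivative[OF bounded_linear_scaleR_right])
  from has_vector_derivative_add[OF has_vector_derivative_const[of p] this]
  show "(reaper_profile f e \<kappa> p has_vector_derivative (1 / (2 * \<kappa>)) *\<^sub>R (f + tan \<xi> *\<^sub>R e)) (at \<xi>)"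
    unfolding reaper_profile_def by simp
  have "((\<lambda>\<xi>. (1 / (2 * \<kappa>)) *\<^sub>R (poly [:0, 1:] (tan \<xi>) *\<^sub>R e + f)) has_vector_derivative
      (1 / (2 * \<kappa>)) *\<^sub>R ((poly (pderiv [:0, 1:] * [:1, 0, 1:]) (tan \<xi>)) *\<^sub>R e)) (at \<xi>)"
    using c by (intro bounded_linear.has_vector_derivative[OF bounded_linear_scaleR_right]
        has_vector_derivative_poly_tan) simp
  then show "((\<lambda>\<xi>. (1 / (2 * \<kappa>)) *\<^sub>R (f + tan \<xi> *\<^sub>R e)) has_vector_derivative
      ((1 + (tan \<xi>)\<^sup>2) / (2 * \<kappa>)) *\<^sub>R e) (at \<xi>)"
    by (simp add: pderiv_pCons power2_eq_square scaleR_add_right add.commute)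
qed

lemma line_deriv: "((\<lambda>r. r *\<^sub>R w) has_vector_derivative w) (at r)"
  for w :: "'a::real_normed_vector"
  by (auto intro!: derivative_eq_intros simp: has_vector_derivative_def)

lemma reaper_cross:
  assumes "frame f e w"
  shows "((1 / (2 * \<kappa>)) *\<^sub>R (f + tan \<xi> *\<^sub>R e)) \<times> w = (1 / (2 * \<kappa>)) *\<^sub>R (tan \<xi> *\<^sub>R f - e)"
  using frame_facts[OF assms]
  by (simp add: cross_add_left cross_mult_left algebra_simps cross_skew[of f w])

text \<open>The rulings contribute no second derivative, and the equation for a sum of two curves
  becomes an identity with both sides equal to
  \<open>- (1 + tan^2 \<xi>) / (4 \<kappa>^2)\<close>.\<close>

lemma soliton_reaper_param:
  assumes F: "frame f e w" and v: "v \<bullet> f = 0" "v \<bullet> e = \<kappa>" and pos: "\<kappa> > 0"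
  shows "soliton_param v strip (reaper_param f e w \<kappa> p)"
proof -
  let ?X = "reaper_param f e w \<kappa> p"
  have S: "open strip"
    by (simp add: open_Times)
  have c: "cos (fst x) \<noteq> 0" if "x \<in> strip" for x :: "real \<times> real"
    using that cos_gt_zero_pi[of "fst x"] by (auto simp: order_less_le)
  note P = sum_curves_partials[where I = "{-(pi/2)<..<pi/2}" and J = UNIV and \<alpha> = "reaper_profile f e \<kappa> p" and \<beta> = "\<lambda>r. r *\<^sub>R w"
      and a = "\<lambda>\<xi>. (1 / (2 * \<kappa>)) *\<^sub>R (f + tan \<xi> *\<^sub>R e)"
      and a' = "\<lambda>\<xi>. ((1 + (tan \<xi>)\<^sup>2) / (2 * \<kappa>)) *\<^sub>R e"
      and b = "\<lambda>_. w" and b' = "\<lambda>_. 0",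
      OF open_greaterThanLessThan open_UNIV _ UNIV_I
      reaper_profile_deriv(1) reaper_profile_deriv(2) line_deriv has_vector_derivative_const,
      folded reaper_param_def]
  have D: "(?X has_derivative (\<lambda>h. fst h *\<^sub>R (1 / (2 * \<kappa>)) *\<^sub>R (f + tan (fst x) *\<^sub>R e) + snd h *\<^sub>R w)) (at x)"
    if "x \<in> strip" for x
    using P(1)[of "fst x" "snd x"] that by auto
  \<comment> \<open>The parametrization contains \<open>ln (cos \<xi>)\<close>, but its first
    derivatives are already polynomials in tan.\<close>
  have "Ck_on k strip (dir_deriv ?X h)" for k h
    by (rule Ck_on_cong[OF S _ Ck_on_poly_tan[OF S c, where p="[:0, fst h / (2 * \<kappa>):]" and e=e
            and c="(fst h / (2 * \<kappa>)) *\<^sub>R f + snd h *\<^sub>R w"]])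
      (subst dir_deriv_eq[OF D], auto simp: algebra_simps)
  moreover have "?X differentiable (at x)" if "x \<in> strip" for x
    using D[OF that] by (auto simp: differentiable_def)
  moreover from this have "continuous_on strip ?X"
    by (simp add: continuous_at_imp_continuous_on differentiable_imp_continuous_within)
  ultimately have "Ck_on k strip ?X" for k
    by (cases k) auto
  then have smooth: "smooth_on strip ?X"
    by (simp add: smooth_on_def)
  have cr: "(1 / (2 * \<kappa>)) *\<^sub>R (tan \<xi> *\<^sub>R f - e) \<noteq> 0" for \<xi>
  proof
    assume "(1 / (2 * \<kappa>)) *\<^sub>R (tan \<xi> *\<^sub>R f - e) = 0"
    then have "(tan \<xi> *\<^sub>R f - e) \<bullet> e = 0"
      using pos by simp
    then show False
      by (simp add: inner_diff_left frame_facts[OF F])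
  qed
  have reg: "regular_param strip ?X"
    unfolding regular_param_def
  proof (intro conjI ballI)
    fix x :: "real \<times> real" assume x: "x \<in> strip"
    show "partial_u ?X x \<times> partial_v ?X x \<noteq> 0"
      using cr[of "fst x"] reaper_cross[OF F, of \<kappa> "fst x"]
      unfolding dir_deriv_eq[OF D[OF x]] by simp
  qed (use S smooth in auto)
  have "mean_curvature ?X (\<xi>, r) = unit_normal ?X (\<xi>, r) \<bullet> v" if "\<xi> \<in> {-(pi/2)<..<pi/2}" for \<xi> r
  proof -
    have vf: "f \<bullet> v = 0" "e \<bullet> v = \<kappa>"
      using v by (simp_all add: inner_commute)
    have n: "((1 / (2 * \<kappa>)) *\<^sub>R (f + tan \<xi> *\<^sub>R e)) \<times> w \<noteq> 0"
      using cr reaper_cross[OF F] by simp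
    have "(w \<bullet> w) * (((1 / (2 * \<kappa>)) *\<^sub>R (tan \<xi> *\<^sub>R f - e)) \<bullet> (((1 + (tan \<xi>)\<^sup>2) / (2 * \<kappa>)) *\<^sub>R e)) =
        2 * (((1 / (2 * \<kappa>)) *\<^sub>R (tan \<xi> *\<^sub>R f - e)) \<bullet> ((1 / (2 * \<kappa>)) *\<^sub>R (tan \<xi> *\<^sub>R f - e))) *
          (((1 / (2 * \<kappa>)) *\<^sub>R (tan \<xi> *\<^sub>R f - e)) \<bullet> v)"
      using pos by (simp add: inner_diff_left inner_diff_right frame_facts[OF F] vf
          field_simps power2_eq_square)
    then show ?thesis
      using sum_curves_soliton_eq[where I = "{-(pi/2)<..<pi/2}" and J = UNIV and \<alpha> = "reaper_profile f e \<kappa> p" and \<beta> = "\<lambda>r. r *\<^sub>R w"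
      and a = "\<lambda>\<xi>. (1 / (2 * \<kappa>)) *\<^sub>R (f + tan \<xi> *\<^sub>R e)"
      and a' = "\<lambda>\<xi>. ((1 + (tan \<xi>)\<^sup>2) / (2 * \<kappa>)) *\<^sub>R e"
      and b = "\<lambda>_. w" and b' = "\<lambda>_. 0",
          OF open_greaterThanLessThan open_UNIV that UNIV_I
          reaper_profile_deriv(1) reaper_profile_deriv(2) line_deriv has_vector_derivative_const n]
      by (simp add: reaper_cross[OF F] reaper_param_def del: inner_scaleR_left inner_scaleR_right)
  qed
  then show ?thesis
    using reg by (auto simp: soliton_param_def)
qed

lemma grim_reaper_reaper_param:
  assumes F: "frame f e w" and v: "v \<bullet> f = 0" "v \<bullet> e = \<kappa>" and pos: "\<kappa> > 0"
  shows "grim_reaper v (reaper_param f e w \<kappa> p ` strip)" (is "grim_reaper v ?M")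
proof -
  let ?X = "reaper_param f e w \<kappa> p"
  note ff = frame_facts[OF F]
  note sol = soliton_reaper_param[OF F v pos, of p]
  have cont: "continuous_on strip ?X"
    using sol unfolding soliton_param_def regular_param_def smooth_on_def
    by (meson Ck_on.simps(1))
  \<comment> \<open>One chart covers the whole surface. Its inverse reads off the coordinates along
    \<open>f\<close> and \<open>w\<close>, because the \<open>f\<close>-coordinate relative to
    \<open>p\<close> is \<open>\<xi> / (2 \<kappa>)\<close>.\<close>
  have "homeomorphism strip ?M ?X (\<lambda>q. (2 * \<kappa> * ((q - p) \<bullet> f), (q - p) \<bullet> w))"
    using cont pos by (intro homeomorphismI)
      (auto intro!: continuous_intros simp: reaper_param_def reaper_profile_def inner_add_left
        inner_diff_left ff)
  then have "local_param ?M strip ?X"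
    using sol unfolding local_param_def soliton_param_def by auto
  then have ts: "translating_soliton v ?M"
    using sol unfolding translating_soliton_def regular_surface_def by blast
  have conn: "connected ?M"
    by (intro connected_continuous_image cont convex_connected convex_Times) auto
  have "(\<lambda>q. q + r *\<^sub>R w) ` ?M \<subseteq> ?M" for r
  proof safe
    fix \<xi> s :: real assume "\<xi> \<in> {-(pi/2)<..<pi/2}"
    then have "?X (\<xi>, s + r) \<in> ?M" by auto
    then show "?X (\<xi>, s) + r *\<^sub>R w \<in> ?M"
      by (simp add: reaper_param_def algebra_simps)
  qed
  moreover have "?M \<subseteq> (\<lambda>q. q + r *\<^sub>R w) ` ?M" for r
  proof
    fix q assume "q \<in> ?M"
    with calculation[of "- r"] have "q + (- r) *\<^sub>R w \<in> ?M" by blast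
    then show "q \<in> (\<lambda>q. q + r *\<^sub>R w) ` ?M"
      by (intro image_eqI[of _ _ "q + (- r) *\<^sub>R w"]) auto
  qed
  moreover have "w \<noteq> 0"
    using ff by auto
  ultimately have cyl: "cylindrical ?M"
    unfolding cylindrical_def by blast
  \<comment> \<open>A normal \<open>n\<close> of a containing plane is orthogonal to
    \<open>w\<close>, as moving along a ruling shows. Comparing \<open>\<xi> = pi/4\<close> and
    \<open>\<xi> = - pi/4\<close> with \<open>\<xi> = 0\<close> gives two equations whose difference
    yields \<open>n \<bullet> f = 0\<close> and whose sum yields
    \<open>n \<bullet> e = 0\<close>.\<close>
  have "\<not> ?M \<subseteq> P" if pl: "is_plane P" for P
  proof
    assume MP: "?M \<subseteq> P"
    obtain n d where n: "n \<noteq> 0" and P: "P = {x. n \<bullet> x = d}"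
      using is_plane_hyperplane[OF pl] .
    have eq: "n \<bullet> ?X (\<xi>, r) = d" if "\<xi> \<in> {-(pi/2)<..<pi/2}" for \<xi> r
      using MP that unfolding P by blast
    have nw: "n \<bullet> w = 0"
      using eq[of 0 0] eq[of 0 1] by (simp add: reaper_param_def inner_add_right)
    have "0 < cos (pi/4)" "cos (pi/4) < 1"
      using cos_monotone_0_pi[of 0 "pi/4"] cos_gt_zero_pi[of "pi/4"] by auto
    then have ln: "ln (cos (pi/4)) \<noteq> 0"
      by simp
    have "n \<bullet> ((pi/4) *\<^sub>R f - ln (cos (pi/4)) *\<^sub>R e) = 0"
      "n \<bullet> ((- (pi/4)) *\<^sub>R f - ln (cos (pi/4)) *\<^sub>R e) = 0"
      using eq[of 0 0] eq[of "pi/4" 0] eq[of "-(pi/4)" 0] pos pi_gt_zero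
      by (simp_all add: reaper_param_def reaper_profile_def inner_add_right)
    then have "n \<bullet> f = 0" "n \<bullet> e = 0"
      using ln by (auto simp: inner_diff_right)
    then have "n = 0"
      using frame_expand[OF F, of n] nw ln by simp
    with n show False by simp
  qed
  then show ?thesis
    using ts conn cyl unfolding grim_reaper_def by blast
qed


section \<open>Sums of a curve and a straight line\<close>

text \<open>With tangent angle \<open>\<theta>\<close>, the equation says
  \<open>\<theta>' = 2 \<kappa> x1\<close>, and the quotient is \<open>cos \<theta>\<close>. The
  derivative of the product is \<open>2 \<kappa> exp (2 \<kappa> y) (y1 cos \<theta> - x1 sin
  \<theta>) = 0\<close>. The case \<open>\<kappa> = 0\<close> serves for curves without
  curvature.\<close>

lemma reaper_first_integral:
  fixes x1 x2 y y1 y2 :: "real \<Rightarrow> real"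
  assumes J: "is_interval J"
    and x1: "\<And>t. t \<in> J \<Longrightarrow> (x1 has_real_derivative x2 t) (at t)"
    and y1: "\<And>t. t \<in> J \<Longrightarrow> (y1 has_real_derivative y2 t) (at t)"
    and y: "\<And>t. t \<in> J \<Longrightarrow> (y has_real_derivative y1 t) (at t)"
    and q: "\<And>t. t \<in> J \<Longrightarrow> (x1 t)\<^sup>2 + (y1 t)\<^sup>2 > 0"
    and eq: "\<And>t. t \<in> J \<Longrightarrow> x1 t * y2 t - y1 t * x2 t = 2 * \<kappa> * ((x1 t)\<^sup>2 + (y1 t)\<^sup>2) * x1 t"
  shows "\<exists>C. \<forall>t\<in>J. x1 t / sqrt ((x1 t)\<^sup>2 + (y1 t)\<^sup>2) * exp (2 * \<kappa> * y t) = C"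
proof (rule constant_on_interval[OF J])
  fix t assume t: "t \<in> J"
  define r where "r = sqrt ((x1 t)\<^sup>2 + (y1 t)\<^sup>2)"
  have r: "r > 0" "(x1 t)\<^sup>2 + (y1 t)\<^sup>2 = r * r"
    using q[OF t] by (simp_all add: r_def)
  have "((\<lambda>t. sqrt ((x1 t)\<^sup>2 + (y1 t)\<^sup>2)) has_real_derivative (x1 t * x2 t + y1 t * y2 t) / r) (at t)"
    using q[OF t] by (auto intro!: derivative_eq_intros x1[OF t] y1[OF t] simp: r_def divide_simps)
  then have "((\<lambda>t. x1 t / sqrt ((x1 t)\<^sup>2 + (y1 t)\<^sup>2)) has_real_derivative
      (x2 t * r - x1 t * ((x1 t * x2 t + y1 t * y2 t) / r)) / (r * r)) (at t)"
    using DERIV_divide[OF x1[OF t]] r unfolding r_def by fastforce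
  moreover have "((\<lambda>t. exp (2 * \<kappa> * y t)) has_real_derivative exp (2 * \<kappa> * y t) * (2 * \<kappa> * y1 t)) (at t)"
    by (auto intro!: derivative_eq_intros y[OF t])
  ultimately have D: "((\<lambda>t. x1 t / sqrt ((x1 t)\<^sup>2 + (y1 t)\<^sup>2) * exp (2 * \<kappa> * y t)) has_real_derivative
      (x2 t * r - x1 t * ((x1 t * x2 t + y1 t * y2 t) / r)) / (r * r) * exp (2 * \<kappa> * y t)
      + exp (2 * \<kappa> * y t) * (2 * \<kappa> * y1 t) * (x1 t / r)) (at t)"
    using DERIV_mult unfolding r_def by blast
  \<comment> \<open>Up to the factor \<open>exp (2 \<kappa> y) / r^3\<close> this is the derivative;
    it equals \<open>y1\<close> times the difference of the two sides of the equation.\<close>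
  have "x2 t * (r * r) - x1 t * (x1 t * x2 t + y1 t * y2 t) + 2 * \<kappa> * y1 t * x1 t * (r * r)
      = y1 t * (2 * \<kappa> * (r * r) * x1 t - (x1 t * y2 t - y1 t * x2 t))"
    unfolding r(2)[symmetric] by (simp add: algebra_simps power2_eq_square)
  also have "\<dots> = 0"
    using eq[OF t] r by simp
  finally have z: "x2 t * (r * r) - x1 t * (x1 t * x2 t + y1 t * y2 t) + 2 * \<kappa> * y1 t * x1 t * (r * r) = 0" .
  have "(x2 t * r - x1 t * ((x1 t * x2 t + y1 t * y2 t) / r)) / (r * r) * E + E * (2 * \<kappa> * y1 t) * (x1 t / r)
      = E * (x2 t * (r * r) - x1 t * (x1 t * x2 t + y1 t * y2 t) + 2 * \<kappa> * y1 t * x1 t * (r * r)) / (r * r * r)"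
    for E
    using r(1) by (simp add: divide_simps) (simp add: algebra_simps)
  with D z show "((\<lambda>t. x1 t / sqrt ((x1 t)\<^sup>2 + (y1 t)\<^sup>2) * exp (2 * \<kappa> * y t)) has_vector_derivative 0) (at t)"
    by (simp add: has_real_derivative_iff_has_vector_derivative)
qed

text \<open>\<open>f\<close> is taken orthogonal to \<open>v\<close> and \<open>w\<close>, so that
  \<open>e\<close> points along the projection of \<open>v\<close>. If \<open>v\<close> is parallel
  to \<open>w\<close>, this leaves \<open>f\<close> free, and it is taken orthogonal to
  \<open>d\<close>; the first integral then vanishes at a point with tangent
  \<open>d\<close>.\<close>

lemma adapted_frame:
  fixes v w d :: "real^3"
  assumes w: "w \<bullet> w = 1" and d: "d \<times> w \<noteq> 0"
  obtains f e where "frame f e w" "v \<bullet> f = 0" "v \<bullet> e \<ge> 0" "v \<bullet> e = 0 \<Longrightarrow> d \<bullet> f = 0"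
proof (cases "v \<times> w = 0")
  case True
  let ?f = "sgn (d \<times> w)"
  have "frame ?f (w \<times> ?f) w"
    using d by (intro frame_exists w) (simp_all add: dot_cross_self)
  moreover have "v \<bullet> ?f = 0"
    using True cross_triple[of v w d] cross_skew[of w d]
    by (simp add: sgn_div_norm inner_commute cross_triple)
  moreover have "v \<bullet> (w \<times> ?f) = 0"
    using True by (metis cross_triple inner_commute inner_zero_left)
  moreover have "d \<bullet> ?f = 0"
    by (simp add: sgn_div_norm dot_cross_self)
  ultimately show ?thesis
    by (intro that) auto
next
  case False
  let ?f = "sgn (v \<times> w)"
  have "frame ?f (w \<times> ?f) w"
    using False by (intro frame_exists w) (simp_all add: dot_cross_self)
  moreover have "v \<bullet> ?f = 0"
    by (simp add: sgn_div_norm dot_cross_self)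
  moreover have "v \<bullet> (w \<times> ?f) > 0"
  proof -
    have "v \<bullet> (w \<times> ?f) = (v \<times> w) \<bullet> ?f"
      by (metis cross_triple inner_commute)
    also have "\<dots> > 0"
      using False by (simp add: sgn_div_norm)
    finally show ?thesis .
  qed
  ultimately show ?thesis
    by (intro that) auto
qed

text \<open>\<open>\<gamma>\<close> moves only along \<open>w\<close>, so its \<open>f\<close>- and
  \<open>e\<close>-coordinates are constants that merely shift the projection of
  \<open>\<delta>\<close>. Whether the first integral \<open>C\<close> is zero decides between plane
  and grim reaper.\<close>

lemma curve_plus_line:
  fixes v w :: "real^3" and \<gamma> \<delta> d d' :: "real \<Rightarrow> real^3"
  assumes I: "is_interval I" and J: "is_interval J"
    and \<gamma>: "\<And>s. s \<in> I \<Longrightarrow> (\<gamma> has_vector_derivative \<rho> s *\<^sub>R w) (at s)"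
    and \<delta>: "\<And>t. t \<in> J \<Longrightarrow> (\<delta> has_vector_derivative d t) (at t)"
    and d: "\<And>t. t \<in> J \<Longrightarrow> (d has_vector_derivative d' t) (at t)"
    and w: "w \<bullet> w = 1"
    and reg: "\<And>t. t \<in> J \<Longrightarrow> d t \<times> w \<noteq> 0"
    and eq: "\<And>t. t \<in> J \<Longrightarrow>
      (d t \<times> w) \<bullet> d' t = 2 * ((d t \<times> w) \<bullet> (d t \<times> w)) * ((d t \<times> w) \<bullet> v)"
  shows "\<exists>M. (is_plane M \<or> grim_reaper v M) \<and> (\<forall>s\<in>I. \<forall>t\<in>J. \<gamma> s + \<delta> t \<in> M)"
proof (cases "J = {}")
  case True
  have "w \<noteq> 0" using w by auto
  with True show ?thesis
    using hyperplane_is_plane[of w 0] by auto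
next
  case False
  then obtain t0 where t0: "t0 \<in> J" by blast
  obtain f e where F: "frame f e w" and vf: "v \<bullet> f = 0" and ve: "v \<bullet> e \<ge> 0"
    and df: "v \<bullet> e = 0 \<Longrightarrow> d t0 \<bullet> f = 0"
    using adapted_frame[OF w reg[OF t0]] by metis
  note ff = frame_facts[OF F]
  define \<kappa> where "\<kappa> = v \<bullet> e"
  define x1 y1 x2 y2 where xy: "x1 = (\<lambda>t. d t \<bullet> f)" "y1 = (\<lambda>t. d t \<bullet> e)"
    "x2 = (\<lambda>t. d' t \<bullet> f)" "y2 = (\<lambda>t. d' t \<bullet> e)"
  have n: "(d t \<times> w) \<bullet> f = y1 t" "(d t \<times> w) \<bullet> e = - x1 t" "(d t \<times> w) \<bullet> w = 0" for t
    by (simp_all add: frame_cross[OF F] ff xy)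
  have q: "(x1 t)\<^sup>2 + (y1 t)\<^sup>2 > 0" if "t \<in> J" for t
  proof -
    have "(d t \<times> w) \<bullet> (d t \<times> w) > 0"
      using reg[OF that] by simp
    then show ?thesis
      by (subst (asm) frame_inner[OF F]) (simp add: n power2_eq_square algebra_simps)
  qed
  have e2: "x1 t * y2 t - y1 t * x2 t = 2 * \<kappa> * ((x1 t)\<^sup>2 + (y1 t)\<^sup>2) * x1 t" if "t \<in> J" for t
  proof -
    have "(d t \<times> w) \<bullet> d' t = y1 t * x2 t - x1 t * y2 t"
      by (subst frame_inner[OF F]) (simp add: n, simp add: xy)
    moreover have "(d t \<times> w) \<bullet> v = - x1 t * \<kappa>"
      by (subst frame_inner[OF F]) (simp add: n vf \<kappa>_def)
    moreover have "(d t \<times> w) \<bullet> (d t \<times> w) = (x1 t)\<^sup>2 + (y1 t)\<^sup>2"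
      by (subst frame_inner[OF F]) (simp add: n power2_eq_square)
    ultimately show ?thesis
      using eq[OF that] by (simp add: algebra_simps)
  qed
  have dx1: "(x1 has_real_derivative x2 t) (at t)" and dy1: "(y1 has_real_derivative y2 t) (at t)"
    and dx: "((\<lambda>t. \<delta> t \<bullet> f) has_real_derivative x1 t) (at t)"
    and dy: "((\<lambda>t. \<delta> t \<bullet> e) has_real_derivative y1 t) (at t)" if "t \<in> J" for t
    using has_real_derivative_inner d \<delta> that unfolding xy by blast+
  obtain C where C: "\<And>t. t \<in> J \<Longrightarrow> x1 t / sqrt ((x1 t)\<^sup>2 + (y1 t)\<^sup>2) * exp (2 * \<kappa> * (\<delta> t \<bullet> e)) = C"
    using reaper_first_integral[OF J dx1 dy1 dy q e2] by blast
  obtain g1 where g1: "\<And>s. s \<in> I \<Longrightarrow> \<gamma> s \<bullet> f = g1"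
    using inner_constant_on_interval[OF I \<gamma>, of f] ff by auto
  obtain g2 where g2: "\<And>s. s \<in> I \<Longrightarrow> \<gamma> s \<bullet> e = g2"
    using inner_constant_on_interval[OF I \<gamma>, of e] ff by auto
  show ?thesis
  proof (cases "C = 0")
    case True
    have "d t \<bullet> f = 0" if "t \<in> J" for t
      using C[OF that] q[OF that] True by (auto simp: xy)
    then obtain h where h: "\<And>t. t \<in> J \<Longrightarrow> \<delta> t \<bullet> f = h"
      using inner_constant_on_interval[OF J \<delta>, of f] by auto
    have "is_plane {x. f \<bullet> x = g1 + h}"
      using ff by (intro hyperplane_is_plane) auto
    moreover have "\<gamma> s + \<delta> t \<in> {x. f \<bullet> x = g1 + h}" if "s \<in> I" "t \<in> J" for s t
      using g1[OF that(1)] h[OF that(2)] by (simp add: inner_add_right inner_commute)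
    ultimately show ?thesis by blast
  next
    case False
    \<comment> \<open>If \<open>\<kappa>\<close> were zero, the choice of the frame would give
      \<open>x1 t0 = 0\<close> and hence \<open>C = 0\<close>.\<close>
    have \<kappa>: "\<kappa> > 0"
      using ve df C[OF t0] False unfolding \<kappa>_def xy by fastforce
    have x1: "x1 t \<noteq> 0" if "t \<in> J" for t
      using C[OF that] False by auto
    \<comment> \<open>The tangent angle, taken modulo \<open>pi\<close>, has derivative
      \<open>2 \<kappa> x1\<close> by the soliton equation, and \<open>x1\<close> is the derivative
      of \<open>\<delta> t \<bullet> f\<close>.\<close>
    have "((\<lambda>t. arctan (y1 t / x1 t) - 2 * \<kappa> * (\<delta> t \<bullet> f)) has_vector_derivative 0) (at t)"
      if t: "t \<in> J" for t
    proof -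
      have "((\<lambda>t. arctan (y1 t / x1 t) - 2 * \<kappa> * (\<delta> t \<bullet> f)) has_real_derivative
          (x1 t * y2 t - y1 t * x2 t) / ((x1 t)\<^sup>2 + (y1 t)\<^sup>2) - 2 * \<kappa> * x1 t) (at t)"
        using x1[OF t] q[OF t]
        by (auto intro!: derivative_eq_intros dx1[OF t] dy1[OF t] dx[OF t]
            simp: power2_eq_square divide_simps)
      then show ?thesis
        using q[OF t] x1[OF t] unfolding e2[OF t]
        by (simp add: has_real_derivative_iff_has_vector_derivative)
    qed
    then obtain D where D: "\<And>t. t \<in> J \<Longrightarrow> arctan (y1 t / x1 t) - 2 * \<kappa> * (\<delta> t \<bullet> f) = D"
      using constant_on_interval[OF J, of "\<lambda>t. arctan (y1 t / x1 t) - 2 * \<kappa> * (\<delta> t \<bullet> f)"]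
      by blast
    \<comment> \<open>The two constants give \<open>2 \<kappa> x = \<xi> - D\<close> and
      \<open>2 \<kappa> y = ln \<bar>C\<bar> - ln (cos \<xi>)\<close> for \<open>\<delta>\<close>;
      \<open>p\<close> collects these shifts and those of \<open>\<gamma>\<close>. The absolute
      value arises because arctan returns an angle with positive cosine, whatever the sign of
      \<open>x1\<close>.\<close>
    define p where "p = (g1 - D / (2 * \<kappa>)) *\<^sub>R f + (g2 + ln \<bar>C\<bar> / (2 * \<kappa>)) *\<^sub>R e"
    have "\<gamma> s + \<delta> t \<in> reaper_param f e w \<kappa> p ` strip" if s: "s \<in> I" and t: "t \<in> J" for s t
    proof -
      define \<xi> where "\<xi> = arctan (y1 t / x1 t)"
      have "1 + (y1 t / x1 t)\<^sup>2 = ((x1 t)\<^sup>2 + (y1 t)\<^sup>2) / (x1 t)\<^sup>2"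
        using x1[OF t] by (simp add: field_simps)
      then have "cos \<xi> = \<bar>x1 t\<bar> / sqrt ((x1 t)\<^sup>2 + (y1 t)\<^sup>2)"
        unfolding \<xi>_def cos_arctan by (simp add: real_sqrt_divide)
      then have "cos \<xi> * exp (2 * \<kappa> * (\<delta> t \<bullet> e)) = \<bar>C\<bar>"
        using C[OF t] q[OF t] by (auto simp: abs_mult)
      moreover have "cos \<xi> > 0"
        unfolding \<xi>_def cos_arctan by (simp add: add_pos_nonneg)
      ultimately have "ln (cos \<xi>) + 2 * \<kappa> * (\<delta> t \<bullet> e) = ln \<bar>C\<bar>"
        by (metis exp_gt_zero ln_exp ln_mult_pos)
      then have y: "\<delta> t \<bullet> e = (ln \<bar>C\<bar> - ln (cos \<xi>)) / (2 * \<kappa>)"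
        using \<kappa> by (simp add: field_simps)
      have x: "\<delta> t \<bullet> f = (\<xi> - D) / (2 * \<kappa>)"
        using D[OF t] \<kappa> by (simp add: \<xi>_def field_simps)
      have "\<gamma> s + \<delta> t = reaper_param f e w \<kappa> p (\<xi>, (\<gamma> s + \<delta> t) \<bullet> w)"
        by (subst frame_expand[OF F])
          (simp add: inner_add_left[of _ _ f] inner_add_left[of _ _ e] g1[OF s] g2[OF s] x y
            reaper_param_def reaper_profile_def p_def algebra_simps diff_divide_distrib)
      moreover have "\<xi> \<in> {-(pi/2)<..<pi/2}"
        using arctan_bounded by (simp add: \<xi>_def)
      ultimately show ?thesis
        by (metis (no_types, lifting) SigmaI UNIV_I imageI)
    qed
    moreover have "grim_reaper v (reaper_param f e w \<kappa> p ` strip)"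
      using grim_reaper_reaper_param[OF F vf _ \<kappa>] by (simp add: \<kappa>_def)
    ultimately show ?thesis by blast
  qed
qed


section \<open>Slopes and straight curves\<close>

lemma finite_slopes:
  fixes z :: real and V c :: complex
  assumes "z \<noteq> 0 \<or> V \<noteq> 0"
  shows "finite {A. A\<^sup>2 * (of_real z * A - V) = c * (1 + A * cnj A)}"
proof (cases "c = 0")
  case True
  have "finite {A. poly [:0, 0, - V, of_real z:] A = 0}"
    using assms by (intro poly_roots_finite) auto
  then show ?thesis
    by (rule rev_finite_subset) (use True in \<open>auto simp: power2_eq_square algebra_simps\<close>)
next
  case False
  define P where "P = [:- c, 0, - V, of_real z:]"
  \<comment> \<open>The equation says \<open>c A cnj A = P(A)\<close>; substituting this into its conjugate, multiplied by
    \<open>(c A)\<^sup>3\<close>, eliminates \<open>cnj A\<close> and leaves \<open>R(A) = 0\<close>.\<close>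
  define R where "R = smult (of_real z) (P ^ 3) - [:0, cnj V * c:] * P\<^sup>2
    - smult (cnj c * c ^ 3) ([:0, 1:] ^ 3) - smult (cnj c * c\<^sup>2) ([:0, 1:] ^ 3 * P)"
  \<comment> \<open>The constant coefficient of \<open>R\<close> is \<open>- z c^3\<close>. If
    \<open>z = 0\<close>, a factor \<open>X\<close> splits off, and the cofactor \<open>S\<close>
    has constant coefficient \<open>cnj V * c^3\<close>, which is non-zero because then
    \<open>V \<noteq> 0\<close>.\<close>
  have "R \<noteq> 0"
  proof (cases "z = 0")
    case True
    define S where "S = [:cnj V * c:] * P\<^sup>2
      + smult (cnj c * c ^ 3) ([:0, 1:]\<^sup>2) + smult (cnj c * c\<^sup>2) ([:0, 1:]\<^sup>2 * P)"
    have "poly S 0 = cnj V * c * c\<^sup>2"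
      by (simp add: S_def P_def)
    then have "S \<noteq> 0"
      using True assms False by auto
    moreover have "R = - ([:0, 1:] * S)"
    proof -
      have "poly R x = poly (- ([:0, 1:] * S)) x" for x
        using True by (simp add: R_def S_def power2_eq_square power3_eq_cube algebra_simps)
      then show ?thesis
        using poly_eq_poly_eq_iff by blast
    qed
    ultimately show ?thesis by simp
  next
    case nz: False
    have "poly R 0 = - of_real z * c ^ 3"
      by (simp add: R_def P_def)
    then show ?thesis
      using nz False by auto
  qed
  moreover have "poly R A = 0" if A: "A\<^sup>2 * (of_real z * A - V) = c * (1 + A * cnj A)" for A
  proof -
    have P: "poly P A = c * A * cnj A"
      using A by (simp add: P_def algebra_simps power2_eq_square)
    have "cnj (A\<^sup>2 * (of_real z * A - V)) = cnj (c * (1 + A * cnj A))"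
      using A by simp
    then have cA: "of_real z * cnj A ^ 3 = cnj V * (cnj A)\<^sup>2 + cnj c * (1 + A * cnj A)"
      by (simp add: algebra_simps power2_eq_square power3_eq_cube)
    have "poly R A = (c * A) ^ 3 * (of_real z * cnj A ^ 3 - (cnj V * (cnj A)\<^sup>2 + cnj c * (1 + A * cnj A)))"
      unfolding R_def by (simp add: P) (simp add: power2_eq_square power3_eq_cube algebra_simps)
    then show ?thesis
      using cA by simp
  qed
  ultimately show ?thesis
    by (intro finite_subset[OF _ poly_roots_finite[of R]]) auto
qed

text \<open>If there were finitely many quotients, continuity would force the quotient near
  \<open>t0\<close> to avoid all values but the one at \<open>t0\<close>. It would be locally
  constant there, against its non-zero derivative.\<close>

lemma infinite_quotients:
  fixes x y :: "real \<Rightarrow> real"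
  assumes J: "open J" "t0 \<in> J"
    and x: "(x has_real_derivative x') (at t0)" and y: "(y has_real_derivative y') (at t0)"
    and x0: "x t0 \<noteq> 0" and W: "x t0 * y' - y t0 * x' \<noteq> 0"
  shows "infinite ((\<lambda>t. y t / x t) ` {t \<in> J. x t \<noteq> 0})"
proof
  let ?m = "\<lambda>t. y t / x t"
  assume fin: "finite (?m ` {t \<in> J. x t \<noteq> 0})"
  have m: "(?m has_real_derivative (y' * x t0 - y t0 * x') / (x t0 * x t0)) (at t0)"
    by (rule DERIV_divide[OF y x x0])
  have cx: "(x \<longlongrightarrow> x t0) (nhds t0)" and cm: "(?m \<longlongrightarrow> ?m t0) (nhds t0)"
    using DERIV_isCont[OF x] DERIV_isCont[OF m]
      tendsto_at_iff_tendsto_nhds[of x t0] tendsto_at_iff_tendsto_nhds[of ?m t0]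
    by (auto simp: isCont_def)
  have "\<forall>\<^sub>F t in nhds t0. x t \<noteq> 0"
    using tendsto_imp_eventually_ne[OF cx x0] .
  moreover have "\<forall>\<^sub>F t in nhds t0. t \<in> J"
    using J by (rule eventually_nhds_in_open)
  moreover have "\<forall>\<^sub>F t in nhds t0. ?m t \<in> - (?m ` {t \<in> J. x t \<noteq> 0} - {?m t0})"
    using fin by (intro topological_tendstoD[OF cm] open_Compl finite_imp_closed) auto
  ultimately have "\<forall>\<^sub>F t in nhds t0. ?m t = ?m t0"
    by eventually_elim auto
  then have "(?m has_real_derivative 0) (at t0)"
    using DERIV_cong_ev[of t0 t0 ?m "\<lambda>_. ?m t0" 0 0] by simp
  from DERIV_unique[OF m this] show False
    using x0 W by (simp add: mult.commute)
qed

lemma continuous_on_finite_range_constant: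
  fixes g :: "real \<Rightarrow> 'a::real_normed_algebra_1"
  assumes "is_interval I" "continuous_on I g" "finite (g ` I)" "s \<in> I" "s0 \<in> I"
  shows "g s = g s0"
  using continuous_finite_range_constant[of I g] assms
  by (metis constant_on_def is_interval_connected_1)

lemma frame_parallel:
  assumes F: "frame e1 e2 e3" and "x \<bullet> e1 = c * y1" "x \<bullet> e2 = c * y2" "x \<bullet> e3 = c * y3"
  shows "x = c *\<^sub>R (y1 *\<^sub>R e1 + y2 *\<^sub>R e2 + y3 *\<^sub>R e3)"
  using frame_expand[OF F, of x] assms(2-) by (simp add: scaleR_add_right)

lemma first_curve_straight:
  fixes v e1 e2 e3 :: "real^3" and a a' b b' :: "real \<Rightarrow> real^3"
  assumes v: "v \<noteq> 0" and F: "frame e1 e2 e3" and I: "is_interval I" and J: "open J"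
    and a: "continuous_on I a"
    and b: "\<And>t. t \<in> J \<Longrightarrow> (b has_vector_derivative b' t) (at t)"
    and b3: "\<And>t. t \<in> J \<Longrightarrow> b t \<bullet> e3 = 0" "\<And>t. t \<in> J \<Longrightarrow> b' t \<bullet> e3 = 0"
    and a0: "\<And>s. s \<in> I \<Longrightarrow> a s \<noteq> 0"
    and eq: "\<And>s t. s \<in> I \<Longrightarrow> t \<in> J \<Longrightarrow> (b t \<bullet> b t) * ((a s \<times> b t) \<bullet> a' s)
      + (a s \<bullet> a s) * ((a s \<times> b t) \<bullet> b' t)
      = 2 * ((a s \<times> b t) \<bullet> (a s \<times> b t)) * ((a s \<times> b t) \<bullet> v)"
    and s0: "s0 \<in> I" "a s0 \<bullet> e3 \<noteq> 0"
    and t0: "t0 \<in> J" "b t0 \<bullet> e1 \<noteq> 0" "(b t0 \<times> b' t0) \<bullet> e3 \<noteq> 0"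
  shows "\<exists>u \<rho>. u \<noteq> 0 \<and> (\<forall>s\<in>I. a s = \<rho> s *\<^sub>R u)"
proof -
  note ff = frame_facts[OF F]
  define m where "m = (\<lambda>t. (b t \<bullet> e2) / (b t \<bullet> e1))"
  define T where "T = {t \<in> J. b t \<bullet> e1 \<noteq> 0}"
  \<comment> \<open>With \<open>m\<close> the slope of \<open>b\<close>, dividing the soliton
    equation by the cube of \<open>b t \<bullet> e1\<close> leaves a polynomial in \<open>m\<close>:
    the quadratic factor comes from the squared normal, the linear ones from triple products with
    \<open>v\<close> and \<open>a'\<close>. Complex coefficients allow evaluation at
    \<open>\<i>\<close>.\<close>
  define P :: "real \<Rightarrow> complex poly" where "P = (\<lambda>s.
    smult 2 (([:of_real (a s \<bullet> a s), 0, of_real (a s \<bullet> a s):] - [:of_real (a s \<bullet> e1), of_real (a s \<bullet> e2):]\<^sup>2)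
      * [:of_real ((v \<times> a s) \<bullet> e1), of_real ((v \<times> a s) \<bullet> e2):])
     - [:1, 0, 1:] * [:of_real ((a' s \<times> a s) \<bullet> e1), of_real ((a' s \<times> a s) \<bullet> e2):])"
  define Q where "Q = (\<lambda>s. smult (1 / of_real ((a s \<bullet> a s) * (a s \<bullet> e3))) (P s))"
  have inf: "infinite (m ` T)"
    unfolding m_def T_def
    by (rule infinite_quotients[OF J t0(1) has_real_derivative_inner[OF b[OF t0(1)]]
          has_real_derivative_inner[OF b[OF t0(1)]] t0(2)])
      (use t0(3) in \<open>simp add: frame_cross[OF F]\<close>)
  \<comment> \<open>The right-hand side involves only \<open>\<beta>\<close>, so the values of
    \<open>Q s\<close> at the slopes are the same for all admissible \<open>s\<close>.\<close>
  have Qm: "poly (Q s) (of_real (m t)) = of_real (((b t \<times> b' t) \<bullet> e3) / (b t \<bullet> e1) ^ 3)"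
    if s: "s \<in> I" "a s \<bullet> e3 \<noteq> 0" and t: "t \<in> T" for s t
  proof -
    define b1 k N a3 where "b1 = b t \<bullet> e1" "k = (b t \<times> b' t) \<bullet> e3" "N = a s \<bullet> a s" "a3 = a s \<bullet> e3"
    note df = this
    define a1 a2 w1 w2 z1 z2 where "a1 = a s \<bullet> e1" "a2 = a s \<bullet> e2"
      "w1 = (v \<times> a s) \<bullet> e1" "w2 = (v \<times> a s) \<bullet> e2"
      "z1 = (a' s \<times> a s) \<bullet> e1" "z2 = (a' s \<times> a s) \<bullet> e2"
    note df2 = this
    have tJ: "t \<in> J" and b1: "b1 \<noteq> 0"
      using t by (auto simp: T_def df)
    have b2: "b t \<bullet> e2 = m t * b1"
      using b1 by (simp add: m_def df)
    have N: "N \<noteq> 0" "a3 \<noteq> 0"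
      using s a0 by (auto simp: df)
    have bb: "b t \<bullet> b t = b1\<^sup>2 * (1 + (m t)\<^sup>2)"
      by (subst frame_inner[OF F]) (simp add: b3[OF tJ] b2 df[symmetric] power2_eq_square algebra_simps)
    have ba: "(a s \<times> b t) \<bullet> a' s = b1 * (z1 + m t * z2)"
    proof -
      have "(a s \<times> b t) \<bullet> a' s = b t \<bullet> (a' s \<times> a s)"
        by (metis cross_triple inner_commute)
      then show ?thesis
        by (subst (asm) frame_inner[OF F, of "b t"])
          (simp add: b3[OF tJ] b2 df[symmetric] df2[symmetric] algebra_simps)
    qed
    have bv: "(a s \<times> b t) \<bullet> v = b1 * (w1 + m t * w2)"
    proof -
      have "(a s \<times> b t) \<bullet> v = b t \<bullet> (v \<times> a s)"
        by (metis cross_triple inner_commute)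
      then show ?thesis
        by (subst (asm) frame_inner[OF F, of "b t"])
          (simp add: b3[OF tJ] b2 df[symmetric] df2[symmetric] algebra_simps)
    qed
    have bb': "(a s \<times> b t) \<bullet> b' t = a3 * k"
    proof -
      have "(a s \<times> b t) \<bullet> b' t = (b t \<times> b' t) \<bullet> a s"
        by (metis cross_triple inner_commute)
      also have "\<dots> = a3 * k"
        by (subst frame_inner[OF F]) (simp add: frame_cross(1,2)[OF F] b3[OF tJ] df)
      finally show ?thesis .
    qed
    have ab: "a s \<bullet> b t = b1 * (a1 + a2 * m t)"
      by (subst frame_inner[OF F]) (simp add: b3[OF tJ] b2 df[symmetric] df2[symmetric] algebra_simps)
    have nn: "(a s \<times> b t) \<bullet> (a s \<times> b t) = b1\<^sup>2 * (N * (1 + (m t)\<^sup>2) - (a1 + a2 * m t)\<^sup>2)"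
      unfolding dot_cross inner_commute[of "b t" "a s"] ab bb df(3)[symmetric]
      by (simp add: power2_eq_square algebra_simps)
    have "b1 ^ 3 * ((1 + (m t)\<^sup>2) * (z1 + m t * z2)) + N * a3 * k =
        b1 ^ 3 * (2 * (N * (1 + (m t)\<^sup>2) - (a1 + a2 * m t)\<^sup>2) * (w1 + m t * w2))"
      using eq[OF s(1) tJ] unfolding bb ba bv bb' nn df(3)[symmetric]
      by (simp add: power2_eq_square power3_eq_cube algebra_simps)
    then have "k / b1 ^ 3 = (2 * (N * (1 + (m t)\<^sup>2) - (a1 + a2 * m t)\<^sup>2) * (w1 + m t * w2)
        - (1 + (m t)\<^sup>2) * (z1 + m t * z2)) / (N * a3)"
      using N b1 by (simp add: field_simps)
    moreover have "poly (P s) (of_real (m t)) = of_real (2 * (N * (1 + (m t)\<^sup>2)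
        - (a1 + a2 * m t)\<^sup>2) * (w1 + m t * w2) - (1 + (m t)\<^sup>2) * (z1 + m t * z2))"
      unfolding P_def df(3,4)[symmetric] df2[symmetric]
      by (simp add: power2_eq_square algebra_simps)
    ultimately show ?thesis
      by (simp add: Q_def df)
  qed
  have QQ: "Q s = Q s0" if "s \<in> I" "a s \<bullet> e3 \<noteq> 0" for s
  proof (rule ccontr)
    assume "Q s \<noteq> Q s0"
    then have "finite {x. poly (Q s - Q s0) x = 0}"
      by (intro poly_roots_finite) simp
    moreover have "(of_real ` m ` T :: complex set) \<subseteq> {x. poly (Q s - Q s0) x = 0}"
      using Qm[OF that] Qm[OF s0] by auto
    ultimately have "finite (of_real ` m ` T :: complex set)"
      by (rule finite_subset[rotated])
    then show False
      using inf finite_imageD[of "of_real :: real \<Rightarrow> complex"] by (auto simp: inj_on_def)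
  qed
  define A where "A = (\<lambda>s. Complex (a s \<bullet> e1 / (a s \<bullet> e3)) (a s \<bullet> e2 / (a s \<bullet> e3)))"
  define V where "V = Complex (v \<bullet> e1) (v \<bullet> e2)"
  define Z where "Z = {B. B\<^sup>2 * (of_real (v \<bullet> e3) * B - V) = poly (Q s0) \<i> * \<i> / 2 * (1 + B * cnj B)}"
  have "v \<bullet> e3 \<noteq> 0 \<or> V \<noteq> 0"
    using v frame_expand[OF F, of v] by (auto simp: V_def complex_eq_iff)
  then have Z: "finite Z"
    unfolding Z_def by (rule finite_slopes)
  have norm_a: "a s \<bullet> a s = (a s \<bullet> e3)\<^sup>2 * (1 + (cmod (A s))\<^sup>2)" if "a s \<bullet> e3 \<noteq> 0" for s
  proof -
    have "(cmod (A s))\<^sup>2 = ((a s \<bullet> e1)\<^sup>2 + (a s \<bullet> e2)\<^sup>2) / (a s \<bullet> e3)\<^sup>2"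
      by (simp add: A_def cmod_power2 power_divide add_divide_distrib)
    then have "(a s \<bullet> e3)\<^sup>2 * (cmod (A s))\<^sup>2 = (a s \<bullet> e1)\<^sup>2 + (a s \<bullet> e2)\<^sup>2"
      using that by simp
    then show ?thesis
      unfolding frame_inner[OF F, of "a s" "a s"] distrib_left by (simp add: power2_eq_square)
  qed
  have AZ: "A s \<in> Z" if s: "s \<in> I" "a s \<bullet> e3 \<noteq> 0" for s
  proof -
    define N a3 where "N = a s \<bullet> a s" "a3 = a s \<bullet> e3"
    note df = this
    have a12: "of_real (a s \<bullet> e1) + \<i> * of_real (a s \<bullet> e2) = of_real a3 * A s"
      using s by (simp add: A_def df complex_eq_iff)
    have w12: "of_real ((v \<times> a s) \<bullet> e1) + \<i> * of_real ((v \<times> a s) \<bullet> e2) =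
        \<i> * of_real a3 * (of_real (v \<bullet> e3) * A s - V)"
      using s by (simp add: A_def V_def df complex_eq_iff frame_cross[OF F] algebra_simps)
    have "N = a3\<^sup>2 * (1 + (cmod (A s))\<^sup>2)"
      using norm_a[OF s(2)] by (simp add: df)
    then have N: "of_real N = of_real a3 ^ 2 * (1 + A s * cnj (A s))"
      by (simp add: complex_norm_square[symmetric])
    have N0: "N \<noteq> 0" "a3 \<noteq> 0"
      using s a0 by (auto simp: df)
    have N1: "1 + A s * cnj (A s) \<noteq> 0"
      using N N0 by auto
    \<comment> \<open>At \<open>\<i>\<close> the factor \<open>1 + m^2\<close> vanishes, and with it
      the whole term containing \<open>a'\<close>; a condition on \<open>A s\<close> alone
      remains.\<close>
    have "poly [:of_real (a s \<bullet> a s), 0, of_real (a s \<bullet> a s):] \<i> = 0" "poly [:1, 0, 1:] \<i> = 0"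
      by (simp_all add: algebra_simps)
    then have "poly (P s) \<i> = - 2 * (of_real (a s \<bullet> e1) + \<i> * of_real (a s \<bullet> e2))\<^sup>2
        * (of_real ((v \<times> a s) \<bullet> e1) + \<i> * of_real ((v \<times> a s) \<bullet> e2))"
      unfolding P_def poly_diff poly_smult poly_mult poly_power by simp
    then have "poly (Q s) \<i> = - 2 * (of_real (a s \<bullet> e1) + \<i> * of_real (a s \<bullet> e2))\<^sup>2
        * (of_real ((v \<times> a s) \<bullet> e1) + \<i> * of_real ((v \<times> a s) \<bullet> e2)) / of_real (N * a3)"
      unfolding Q_def df by simp
    also have "\<dots> = - 2 * \<i> * ((A s)\<^sup>2 * (of_real (v \<bullet> e3) * A s - V)) / (1 + A s * cnj (A s))"
      unfolding a12 w12 of_real_mult N using N0 N1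
      by (simp add: divide_simps power2_eq_square)
    finally have "poly (Q s) \<i> * (1 + A s * cnj (A s)) = - 2 * \<i> * ((A s)\<^sup>2 * (of_real (v \<bullet> e3) * A s - V))"
      using N1 by simp
    then have "(A s)\<^sup>2 * (of_real (v \<bullet> e3) * A s - V) = \<i> / 2 * (poly (Q s) \<i> * (1 + A s * cnj (A s)))"
      by simp
    then have "(A s)\<^sup>2 * (of_real (v \<bullet> e3) * A s - V) = poly (Q s) \<i> * \<i> / 2 * (1 + A s * cnj (A s))"
      by (simp only:) simp
    then show ?thesis
      unfolding Z_def QQ[OF s] by simp
  qed
  \<comment> \<open>The slope \<open>A\<close> is meaningful only where
    \<open>a s \<bullet> e3 \<noteq> 0\<close>, so its continuity on \<open>I\<close> is not yet
    available. The normalized component is continuous on all of \<open>I\<close> and takes finitely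
    many values, namely 0 and those determined up to sign by \<open>Z\<close>; being constant and
    non-zero at \<open>s0\<close>, it never vanishes.\<close>
  have a3n: "(a s \<bullet> e3) / norm (a s) = (a s0 \<bullet> e3) / norm (a s0)" if "s \<in> I" for s
  proof (rule continuous_on_finite_range_constant[OF I _ _ that s0(1)])
    show "continuous_on I (\<lambda>s. (a s \<bullet> e3) / norm (a s))"
      using a a0 by (auto intro!: continuous_intros)
    have fin: "(a s \<bullet> e3) / norm (a s) \<in> insert 0
        ((\<lambda>B. 1 / sqrt (1 + (cmod B)\<^sup>2)) ` Z \<union> (\<lambda>B. - 1 / sqrt (1 + (cmod B)\<^sup>2)) ` Z)"
      if s: "s \<in> I" for s
    proof (cases "a s \<bullet> e3 = 0")
      case False
      have "norm (a s) = \<bar>a s \<bullet> e3\<bar> * sqrt (1 + (cmod (A s))\<^sup>2)"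
        by (simp add: norm_a[OF False] norm_eq_sqrt_inner real_sqrt_mult)
      then have "(a s \<bullet> e3) / norm (a s) = sgn (a s \<bullet> e3) / sqrt (1 + (cmod (A s))\<^sup>2)"
        using False by (simp add: sgn_real_def abs_if)
      with AZ[OF s False] False show ?thesis
        by (auto simp: sgn_real_def)
    qed auto
    show "finite ((\<lambda>s. (a s \<bullet> e3) / norm (a s)) ` I)"
      by (rule finite_subset[OF image_subsetI[OF fin]]) (use Z in auto)
  qed
  have a3: "a s \<bullet> e3 \<noteq> 0" if "s \<in> I" for s
    using a3n[OF that] s0 a0 by auto
  have AA: "A s = A s0" if "s \<in> I" for s
  proof (rule continuous_on_finite_range_constant[OF I _ _ that s0(1)])
    show "continuous_on I A"
      unfolding A_def Complex_eq using a a3 by (auto intro!: continuous_intros)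
    show "finite (A ` I)"
      using AZ a3 by (intro finite_subset[OF _ Z]) auto
  qed
  define u where "u = Re (A s0) *\<^sub>R e1 + Im (A s0) *\<^sub>R e2 + 1 *\<^sub>R e3"
  have "u \<bullet> e3 = 1"
    by (simp add: u_def inner_add_left ff)
  then have "u \<noteq> 0"
    by auto
  moreover have "a s = (a s \<bullet> e3) *\<^sub>R u" if "s \<in> I" for s
    unfolding u_def AA[OF that, symmetric] using a3[OF that]
    by (intro frame_parallel[OF F]) (simp_all add: A_def)
  ultimately show ?thesis
    by (intro exI[of _ u] exI[of _ "\<lambda>s. a s \<bullet> e3"]) simp
qed

text \<open>This is the first integral for \<open>\<kappa> = 0\<close> with \<open>e2\<close> as the
  first axis: the sine of the tangent angle relative to \<open>e1\<close> is constant, and it is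
  zero at \<open>t0\<close>.\<close>

lemma constant_direction:
  fixes \<beta> b b' :: "real \<Rightarrow> real^3"
  assumes F: "frame e1 e2 e3" and J: "is_interval J"
    and \<beta>: "\<And>t. t \<in> J \<Longrightarrow> (\<beta> has_vector_derivative b t) (at t)"
    and b: "\<And>t. t \<in> J \<Longrightarrow> (b has_vector_derivative b' t) (at t)"
    and b3: "\<And>t. t \<in> J \<Longrightarrow> b t \<bullet> e3 = 0"
    and b0: "\<And>t. t \<in> J \<Longrightarrow> b t \<noteq> 0"
    and W: "\<And>t. t \<in> J \<Longrightarrow> (b t \<times> b' t) \<bullet> e3 = 0"
    and t0: "t0 \<in> J" "b t0 \<bullet> e2 = 0"
    and t: "t \<in> J"
  shows "b t = (b t \<bullet> e1) *\<^sub>R e1"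
proof -
  have q: "(b t \<bullet> e2)\<^sup>2 + (b t \<bullet> e1)\<^sup>2 > 0" if "t \<in> J" for t
  proof -
    have "b t \<bullet> b t > 0"
      using b0[OF that] by simp
    then show ?thesis
      by (subst (asm) frame_inner[OF F]) (simp add: b3[OF that] power2_eq_square)
  qed
  have "(b t \<bullet> e2) * (b' t \<bullet> e1) - (b t \<bullet> e1) * (b' t \<bullet> e2)
      = 2 * 0 * ((b t \<bullet> e2)\<^sup>2 + (b t \<bullet> e1)\<^sup>2) * (b t \<bullet> e2)" if "t \<in> J" for t
    using W[OF that] by (simp add: frame_cross[OF F])
  from reaper_first_integral[OF J has_real_derivative_inner[OF b] has_real_derivative_inner[OF b]
      has_real_derivative_inner[OF \<beta>] q this]
  obtain C where C: "\<And>t. t \<in> J \<Longrightarrow> (b t \<bullet> e2) / sqrt ((b t \<bullet> e2)\<^sup>2 + (b t \<bullet> e1)\<^sup>2) = C"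
    by auto
  have "b t \<bullet> e2 = 0"
    using C[OF t0(1)] C[OF t] q[OF t] t0(2) by auto
  then show ?thesis
    using frame_expand[OF F, of "b t"] b3[OF t] by simp
qed

text \<open>The term with \<open>g'\<close> drops out because \<open>g'\<close> is parallel to
  \<open>w\<close>; the others are homogeneous of degree 3 in \<open>r\<close>, so the speed
  cancels.\<close>

lemma soliton_eq_line:
  fixes d d' g g' v w :: "real^3"
  assumes eq: "(g \<bullet> g) * ((d \<times> g) \<bullet> d') + (d \<bullet> d) * ((d \<times> g) \<bullet> g')
      = 2 * ((d \<times> g) \<bullet> (d \<times> g)) * ((d \<times> g) \<bullet> v)"
    and g: "g = r *\<^sub>R w" "g \<noteq> 0" and w: "w \<bullet> w = 1" and g': "w \<times> g' = 0"
  shows "(d \<times> w) \<bullet> d' = 2 * ((d \<times> w) \<bullet> (d \<times> w)) * ((d \<times> w) \<bullet> v)"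
proof -
  have "(d \<times> w) \<bullet> g' = 0"
    using g' by (metis cross_triple inner_commute inner_zero_left)
  then have "r ^ 3 * ((d \<times> w) \<bullet> d') = r ^ 3 * (2 * ((d \<times> w) \<bullet> (d \<times> w)) * ((d \<times> w) \<bullet> v))"
    using eq w unfolding g(1) cross_mult_right
    by (simp add: power3_eq_cube mult.assoc mult.left_commute)
  moreover have "r \<noteq> 0"
    using g by auto
  ultimately show ?thesis
    by simp
qed

section \<open>Reduction of the sum of two curves to a plane or to a curve plus a line\<close>

unbundle no cross3_syntax

theorem theorem2:
  fixes v :: "real^3"
    and I J :: "real set"
    and \<alpha> \<beta> :: "real \<Rightarrow> real^3"
  assumes "v \<noteq> 0"
    and "open I" "is_interval I"
    and "open J" "is_interval J"
    and "smooth_on I \<alpha>"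
    and "smooth_on J \<beta>"
    and "\<exists>Q. is_plane Q \<and> \<beta> ` J \<subseteq> Q"
    and "soliton_param v (I \<times> J) (\<lambda>(s, t). \<alpha> s + \<beta> t)"
  shows "\<exists>M. (is_plane M \<or> grim_reaper v M) \<and> (\<lambda>(s, t). \<alpha> s + \<beta> t) ` (I \<times> J) \<subseteq> M"
proof (cases "I = {} \<or> J = {}")
  case True
  with hyperplane_is_plane[OF \<open>v \<noteq> 0\<close>] show ?thesis
    by (intro exI[of _ "{x. v \<bullet> x = 0}"]) auto
next
  case False
  note v = assms(1) and I = assms(2,3) and J = assms(4,5)
  define a a' b b' where "a = dir_deriv \<alpha> 1" "a' = dir_deriv a 1"
    "b = dir_deriv \<beta> 1" "b' = dir_deriv b 1"
  note df = this
  have \<alpha>: "(\<alpha> has_vector_derivative a s) (at s)" and a: "(a has_vector_derivative a' s) (at s)"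
    if "s \<in> I" for s
    using smooth_on_has_vector_derivative that assms(6) smooth_on_dir_deriv unfolding df by blast+
  have \<beta>: "(\<beta> has_vector_derivative b t) (at t)" and b: "(b has_vector_derivative b' t) (at t)"
    if "t \<in> J" for t
    using smooth_on_has_vector_derivative that assms(7) smooth_on_dir_deriv unfolding df by blast+
  have ca: "continuous_on I a"
    using a by (meson continuous_at_imp_continuous_on has_vector_derivative_continuous)
  define X where "X = (\<lambda>(s, t). \<alpha> s + \<beta> t)"
  have sol: "soliton_param v (I \<times> J) X"
    using assms(9) by (simp add: X_def)
  have n: "cross3 (a s) (b t) \<noteq> 0" if "s \<in> I" "t \<in> J" for s t
  proof -
    have "cross3 (partial_u X (s, t)) (partial_v X (s, t)) \<noteq> 0"
      using sol that unfolding soliton_param_def regular_param_def by blast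
    then show ?thesis
      by (simp add: X_def sum_curves_partials(2)[OF I(1) J(1) that \<alpha> a \<beta> b])
  qed
  have eq: "(b t \<bullet> b t) * (cross3 (a s) (b t) \<bullet> a' s) + (a s \<bullet> a s) * (cross3 (a s) (b t) \<bullet> b' t)
      = 2 * (cross3 (a s) (b t) \<bullet> cross3 (a s) (b t)) * (cross3 (a s) (b t) \<bullet> v)"
    if "s \<in> I" "t \<in> J" for s t
  proof -
    have "mean_curvature X (s, t) = unit_normal X (s, t) \<bullet> v"
      using sol that unfolding soliton_param_def by blast
    then show ?thesis
      using sum_curves_soliton_eq[OF I(1) J(1) that \<alpha> a \<beta> b n[OF that], of v]
      by (simp add: X_def)
  qed
  have a0: "a s \<noteq> 0" if "s \<in> I" for s
    using n[OF that] False by fastforce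
  have b0: "b t \<noteq> 0" if "t \<in> J" for t
    using n[OF _ that] False by fastforce
  obtain m c where m: "m \<noteq> 0" and \<beta>m: "\<And>t. t \<in> J \<Longrightarrow> \<beta> t \<bullet> m = c"
    using assms(8) is_plane_hyperplane by (smt (verit) image_subset_iff inner_commute mem_Collect_eq)
  define e3 where "e3 = sgn m"
  have e3: "e3 \<bullet> e3 = 1"
    using m norm_sgn[of m] by (simp add: e3_def dot_square_norm)
  have \<beta>3: "\<beta> t \<bullet> e3 = c / norm m" if "t \<in> J" for t
    using \<beta>m[OF that] by (simp add: e3_def sgn_div_norm divide_inverse mult.commute)
  have b3: "b t \<bullet> e3 = 0" if "t \<in> J" for t
    using derivative_inner_constant[OF J(1) that \<beta>[OF that]] \<beta>3 by blast
  have b'3: "b' t \<bullet> e3 = 0" if "t \<in> J" for t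
    using derivative_inner_constant[OF J(1) that b[OF that]] b3 by blast
  \<comment> \<open>\<open>t0\<close> is a point where the curvature of \<open>\<beta>\<close> is
    non-zero if there is one, and any point of \<open>J\<close> otherwise.\<close>
  obtain t0 where t0: "t0 \<in> J"
    and W: "cross3 (b t0) (b' t0) \<bullet> e3 = 0 \<Longrightarrow> (\<forall>t\<in>J. cross3 (b t) (b' t) \<bullet> e3 = 0)"
    using False by blast
  \<comment> \<open>Taking \<open>e1\<close> along \<open>b t0\<close> makes the slope of
    \<open>b\<close> defined at \<open>t0\<close> and also provides the initial condition
    \<open>b t0 \<bullet> e2 = 0\<close> for a \<open>\<beta>\<close> without curvature.\<close>
  define e1 e2 where "e1 = sgn (b t0)" "e2 = cross3 e3 e1"
  have F: "frame e1 e2 e3"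
    unfolding e1_e2_def by (rule frame_exists[OF e3 b3[OF t0] b0[OF t0]])
  have e1: "b t0 = norm (b t0) *\<^sub>R e1"
    using b0[OF t0] by (simp add: e1_e2_def sgn_div_norm)
  have b12: "b t0 \<bullet> e1 \<noteq> 0" "b t0 \<bullet> e2 = 0"
    by (subst e1, simp add: frame_facts[OF F] b0[OF t0])+
  consider (plane) "\<forall>s\<in>I. a s \<bullet> e3 = 0"
    | (second) "\<forall>t\<in>J. cross3 (b t) (b' t) \<bullet> e3 = 0"
    | (first) s0 where "s0 \<in> I" "a s0 \<bullet> e3 \<noteq> 0" "cross3 (b t0) (b' t0) \<bullet> e3 \<noteq> 0"
    using W by blast
  then show ?thesis
  proof cases
    case plane
    then obtain h where h: "\<And>s. s \<in> I \<Longrightarrow> \<alpha> s \<bullet> e3 = h"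
      using inner_constant_on_interval[OF I(2) \<alpha>, of e3] by blast
    have "is_plane {x. e3 \<bullet> x = h + c / norm m}"
      using e3 by (intro hyperplane_is_plane) auto
    moreover have "(\<lambda>(s, t). \<alpha> s + \<beta> t) ` (I \<times> J) \<subseteq> {x. e3 \<bullet> x = h + c / norm m}"
      using h \<beta>3 by (auto simp: inner_add_right inner_commute)
    ultimately show ?thesis by blast
  next
    case second
    have be: "b t = (b t \<bullet> e1) *\<^sub>R e1" if "t \<in> J" for t
      using constant_direction[OF F J(2) \<beta> b b3 b0 _ t0 b12(2) that] second by blast
    have e11: "e1 \<bullet> e1 = 1"
      by (rule frame_facts[OF F])
    \<comment> \<open>Here \<open>\<beta>\<close> is the straight curve and \<open>\<alpha>\<close>
      the general one.\<close>
    have "\<exists>M. (is_plane M \<or> grim_reaper v M) \<and> (\<forall>t\<in>J. \<forall>s\<in>I. \<beta> t + \<alpha> s \<in> M)"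
    proof (rule curve_plus_line[OF J(2) I(2) _ \<alpha> a e11])
      show "(\<beta> has_vector_derivative (b t \<bullet> e1) *\<^sub>R e1) (at t)" if "t \<in> J" for t
        using \<beta>[OF that] be[OF that] by simp
      fix s assume s: "s \<in> I"
      have "cross3 (a s) ((b t0 \<bullet> e1) *\<^sub>R e1) \<noteq> 0"
        using n[OF s t0] be[OF t0] by simp
      then show "cross3 (a s) e1 \<noteq> 0"
        by (auto simp: cross_mult_right)
      show "cross3 (a s) e1 \<bullet> a' s =
          2 * (cross3 (a s) e1 \<bullet> cross3 (a s) e1) * (cross3 (a s) e1 \<bullet> v)"
        using soliton_eq_line[OF eq[OF s t0] be[OF t0] b0[OF t0] e11]
          derivative_parallel[OF J(1) t0 b[OF t0] be] by blast
    qed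
    then show ?thesis
      by (force simp: add.commute)
  next
    case first
    obtain u \<rho> where u: "u \<noteq> 0" and au: "\<And>s. s \<in> I \<Longrightarrow> a s = \<rho> s *\<^sub>R u"
      using first_curve_straight[OF v F I(2) J(1) ca b b3 b'3 a0 eq first(1,2) t0 b12(1) first(3)]
      by blast
    define w where "w = sgn u"
    have w: "w \<bullet> w = 1"
      using u norm_sgn[of u] by (simp add: w_def dot_square_norm)
    have aw: "a s = (\<rho> s * norm u) *\<^sub>R w" if "s \<in> I" for s
      using au[OF that] u by (simp add: w_def sgn_div_norm)
    have "\<exists>M. (is_plane M \<or> grim_reaper v M) \<and> (\<forall>s\<in>I. \<forall>t\<in>J. \<alpha> s + \<beta> t \<in> M)"
    proof (rule curve_plus_line[OF I(2) J(2) _ \<beta> b w])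
      show "(\<alpha> has_vector_derivative (\<rho> s * norm u) *\<^sub>R w) (at s)" if "s \<in> I" for s
        using \<alpha>[OF that] aw[OF that] by simp
      fix t assume t: "t \<in> J"
      have "cross3 ((\<rho> s0 * norm u) *\<^sub>R w) (b t) \<noteq> 0"
        using n[OF first(1) t] aw[OF first(1)] by simp
      then show "cross3 (b t) w \<noteq> 0"
        using cross_skew[of w "b t"] by (auto simp: cross_mult_left)
      \<comment> \<open>Exchanging the two curves reverses the normal, and both sides of the
        equation are odd in it.\<close>
      have "(a s0 \<bullet> a s0) * (cross3 (b t) (a s0) \<bullet> b' t) + (b t \<bullet> b t) * (cross3 (b t) (a s0) \<bullet> a' s0)
          = 2 * (cross3 (b t) (a s0) \<bullet> cross3 (b t) (a s0)) * (cross3 (b t) (a s0) \<bullet> v)"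
        using eq[OF first(1) t] unfolding cross_skew[of "a s0" "b t"] by simp
      then show "cross3 (b t) w \<bullet> b' t =
          2 * (cross3 (b t) w \<bullet> cross3 (b t) w) * (cross3 (b t) w \<bullet> v)"
        using soliton_eq_line[OF _ aw[OF first(1)] a0[OF first(1)] w]
          derivative_parallel[OF I(1) first(1) a[OF first(1)] aw] by blast
    qed
    then show ?thesis
      by fastforce
  qed
qed

end
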